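(* Let $k\subset\mathbb{C}$ be a number field stable under complex conjugation and let $(V,G)$ be a finite irreducible well-generated reflection group over $k$. If $\mathfrak{R}$ and $\mathfrak{R}'$ are two distinguished $\mathbb{Z}_k$-root systems with $G(\mathfrak{R})=G(\mathfrak{R}')=G$, then the connection indices of $\mathfrak R$ and of $\mathfrak R'$ are equal. (The common value is called the connection index of $(V,G)$.)
   Context: $\mathbb{Z}_k$ is the ring of integers of $k$; $\lambda\mapsto\lambda^*$ is complex conjugation. $(V,W)$ is a pair of finite dimensional $k$-vector spaces with a Hermitian pairing $\langle\cdot,\cdot\rangle:V\times W\to k$ (linear in $V$, semi-linear in $W$, non-degenerate on both sides). For $g\in\mathrm{GL}(V)$, $g^\vee\in\mathrm{GL}(W)$ is the unique element with $\langle gv,g^\vee w\rangle=\langle v,w\rangle$. A reflection is an $s\in\mathrm{GL}(V)$ of finite order with $H_s=\ker(s-1)$ a hyperplane. A finite reflection group $(V,G)$ is a finite subgroup $G\subset\mathrm{GL}(V)$ generated by reflections; it is irreducible if $V$ is an irreducible $G$-representation, and well-generated if $G$ can be generated by $\dim V$ reflections. A reflection $s\in G$ is distinguished if $\det s=\exp(2\pi i/d)$ with $d=|C_G(H_s)|$, where $C_G(H_s)$ is the pointwise stabilizer of $H_s$ in $G$. A $\mathbb{Z}_k$-root is a triple $\mathfrak r=(I,J,\zeta)$ with $I\subset V$, $J\subset W$ rank one finitely generated $\mathbb{Z}_k$-submodules, $\zeta\ne1$ a root of unity in $k$, and $\langle I,J\rangle=(1-\zeta)\mathbb{Z}_k$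 ($\langle I,J\rangle$ being the fractional ideal generated by all $\langle\alpha,\beta\rangle$, $\alpha\in I$, $\beta\in J$). Its reflection is $s_{\mathfrak r}(x)=x-\langle x,w\rangle v$ for $v\in kI,w\in kJ$ with $\langle v,w\rangle=1-\zeta$. $\mathrm{GL}(V)$ acts by $g\cdot(I,J,\zeta)=(g(I),g^\vee(J),\zeta)$. A $\mathbb{Z}_k$-root system is a finite set $\mathfrak R$ of $\mathbb{Z}_k$-roots whose modules $I_{\mathfrak r}$ generate $V$, with $s_{\mathfrak r}\cdot\mathfrak R=\mathfrak R$ for all $\mathfrak r\in\mathfrak R$ and $\langle I_{\mathfrak r_1},J_{\mathfrak r_2}\rangle\subseteq\mathbb{Z}_k$ for all $\mathfrak r_1,\mathfrak r_2\in\mathfrak R$. $G(\mathfrak R)$ is the group generated by the $s_{\mathfrak r}$. $\mathfrak R$ is distinguished if $\mathfrak r\mapsto s_{\mathfrak r}$ is injective on $\mathfrak R$ and every $s_{\mathfrak r}$ is a distinguished reflection of $G(\mathfrak R)$. The root lattice is $Q_{\mathfrak R}=\sum_{\mathfrak r}I_{\mathfrak r}$, the coroot lattice is $Q^\vee_{\mathfrak R}=\sum_{\mathfrak r}J_{\mathfrak r}$, and the weight lattice is $P_{\mathfrak R}=\{x\in V\mid\langle x,Q^\vee_{\mathfrak R}\rangle\subseteq\mathbb{Z}_k\}\supseteq Q_{\mathfrak R}$. With $r=\dim V$, the connection index of $\mathfrak R$ is the characteristic ideal $\mathrm{Ch}(P_{\mathfrak R}/Q_{\mathfrak R})$ of the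 torsion module $P_{\mathfrak R}/Q_{\mathfrak R}$, i.e. the ideal of $\mathbb{Z}_k$ defined by $\bigwedge^rQ_{\mathfrak R}=\mathrm{Ch}(P_{\mathfrak R}/Q_{\mathfrak R})\bigwedge^rP_{\mathfrak R}$. *)

theory Defs
  imports
    Complex_Main
    "HOL-Library.Function_Algebras"
    "HOL-Computational_Algebra.Polynomial"
    "HOL-Algebra.Generated_Groups"
begin

section \<open>The base field and the Hermitian pairing\<close>

text \<open>
  The field \<open>k\<close> is a type together with an embedding into the complex numbers; \<open>V\<close>, \<open>W\<close> and \<open>k\<close>
  are whole types, while the ring of integers of \<open>k\<close> and its modules are sets.
\<close>

locale conj_stable_number_field =
  fixes emb :: "'k::field_char_0 \<Rightarrow> complex"
  assumes emb_one: "emb 1 = 1"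
    and emb_add: "emb (x + y) = emb x + emb y"
    and emb_mult: "emb (x * y) = emb x * emb y"
    and finite_degree: "\<exists>B. finite B \<and> module.span (\<lambda>(q::rat) (x::'k). of_rat q * x) B = UNIV"
    and conj_stable: "cnj (emb x) \<in> range emb"

locale hermitian_pairing = conj_stable_number_field emb + V: vector_space sV + W: vector_space sW
  for emb :: "'k::field_char_0 \<Rightarrow> complex"
    and sV :: "'k \<Rightarrow> 'v::ab_group_add \<Rightarrow> 'v"
    and sW :: "'k \<Rightarrow> 'w::ab_group_add \<Rightarrow> 'w" +
  fixes pair :: "'v \<Rightarrow> 'w \<Rightarrow> 'k"
  assumes finite_dim_V: "\<exists>B. finite B \<and> V.span B = UNIV"
    and finite_dim_W: "\<exists>B. finite B \<and> W.span B = UNIV"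
    and pair_add_left: "pair (v + v') w = pair v w + pair v' w"
    and pair_scale_left: "pair (sV c v) w = c * pair v w"
    and pair_add_right: "pair v (w + w') = pair v w + pair v w'"
    and pair_scale_right: "emb (pair v (sW c w)) = cnj (emb c) * emb (pair v w)"
    and nondegenerate_left: "(\<And>w. pair v w = 0) \<Longrightarrow> v = 0"
    and nondegenerate_right: "(\<And>v. pair v w = 0) \<Longrightarrow> w = 0"


section \<open>Modules over the ring of integers\<close>

definition integers_of :: "'k::field_char_0 set" where
  "integers_of = {x. algebraic_int x}"

text \<open>
  In the following, \<open>s\<close> is a scalar multiplication by \<open>k\<close>; it is multiplication of \<open>k\<close> itself when
  (fractional) ideals are considered.
\<close>

definition int_submodule :: "('k::field_char_0 \<Rightarrow> 'm::ab_group_add \<Rightarrow> 'm) \<Rightarrow> 'm set \<Rightarrow> bool" where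
  "int_submodule s M \<longleftrightarrow>
     0 \<in> M \<and> (\<forall>x\<in>M. \<forall>y\<in>M. x + y \<in> M) \<and> (\<forall>c\<in>integers_of. \<forall>x\<in>M. s c x \<in> M)"

definition int_span :: "('k::field_char_0 \<Rightarrow> 'm::ab_group_add \<Rightarrow> 'm) \<Rightarrow> 'm set \<Rightarrow> 'm set" where
  "int_span s X = int_submodule s hull X"

text \<open>
  The modules below live in a vector space over \<open>k\<close>, the field of fractions of the ring of integers,
  so their rank is the dimension of the \<open>k\<close>-subspace they span.
\<close>

definition rank_one_fg_module :: "('k::field_char_0 \<Rightarrow> 'm::ab_group_add \<Rightarrow> 'm) \<Rightarrow> 'm set \<Rightarrow> bool" where
  "rank_one_fg_module s M \<longleftrightarrow>
     int_submodule s M \<and> (\<exists>X. finite X \<and> M = int_span s X) \<and> vector_space.dim s M = 1"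

definition int_ideal :: "'k::field_char_0 set \<Rightarrow> bool" where
  "int_ideal \<aa> \<longleftrightarrow> int_submodule (*) \<aa> \<and> \<aa> \<subseteq> integers_of"

definition ideal_times ::
    "('k::field_char_0 \<Rightarrow> 'm::ab_group_add \<Rightarrow> 'm) \<Rightarrow> 'k set \<Rightarrow> 'm set \<Rightarrow> 'm set" where
  "ideal_times s \<aa> M = int_span s {s a x | a x. a \<in> \<aa> \<and> x \<in> M}"


section \<open>Exterior powers and determinants\<close>

text \<open>
  An alternating form of degree \<open>r\<close> is only constrained on lists of length \<open>r\<close>. The \<open>r\<close>-th exterior power
  of a finite dimensional space \<open>V\<close> is identified with the dual of the space of alternating forms of
  degree \<open>r\<close> on \<open>V\<close>: the product of \<open>x\<^sub>1, \<dots>, x\<^sub>r\<close> is the evaluation of forms at \<open>(x\<^sub>1, \<dots>, x\<^sub>r)\<close>.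
\<close>

definition alternating_form ::
    "('k::field_char_0 \<Rightarrow> 'v::ab_group_add \<Rightarrow> 'v) \<Rightarrow> nat \<Rightarrow> ('v list \<Rightarrow> 'k) \<Rightarrow> bool" where
  "alternating_form s r \<omega> \<longleftrightarrow> (\<forall>xs. length xs = r \<longrightarrow>
     (\<forall>i<r. Vector_Spaces.linear s (*) (\<lambda>x. \<omega> (xs[i := x]))) \<and>
     (\<forall>i<r. \<forall>j<r. i \<noteq> j \<and> xs ! i = xs ! j \<longrightarrow> \<omega> xs = 0))"

definition wedge ::
    "('k::field_char_0 \<Rightarrow> 'v::ab_group_add \<Rightarrow> 'v) \<Rightarrow> 'v list \<Rightarrow> ('v list \<Rightarrow> 'k) \<Rightarrow> 'k" where
  "wedge s xs = (\<lambda>\<omega>. if alternating_form s (length xs) \<omega> then \<omega> xs else 0)"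

definition scale_fun :: "'k::field_char_0 \<Rightarrow> ('a \<Rightarrow> 'k) \<Rightarrow> 'a \<Rightarrow> 'k" where
  "scale_fun c f = (\<lambda>x. c * f x)"

definition exterior_power ::
    "('k::field_char_0 \<Rightarrow> 'v::ab_group_add \<Rightarrow> 'v) \<Rightarrow> nat \<Rightarrow> 'v set \<Rightarrow> (('v list \<Rightarrow> 'k) \<Rightarrow> 'k) set" where
  "exterior_power s r L = int_span scale_fun {wedge s xs | xs. length xs = r \<and> set xs \<subseteq> L}"

text \<open>The scalar by which an endomorphism acts on the top exterior power:\<close>

definition endo_det :: "('k::field_char_0 \<Rightarrow> 'v::ab_group_add \<Rightarrow> 'v) \<Rightarrow> ('v \<Rightarrow> 'v) \<Rightarrow> 'k" where
  "endo_det s g = (THE d. \<forall>xs. length xs = vector_space.dim s UNIV \<longrightarrow>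
     wedge s (map g xs) = scale_fun d (wedge s xs))"


section \<open>Reflection groups\<close>

definition GL :: "('k::field_char_0 \<Rightarrow> 'v::ab_group_add \<Rightarrow> 'v) \<Rightarrow> ('v \<Rightarrow> 'v) monoid" where
  "GL s = \<lparr>carrier = {g. Vector_Spaces.linear s s g \<and> bij g}, mult = (\<circ>), one = id\<rparr>"

definition fixed_space :: "('v \<Rightarrow> 'v) \<Rightarrow> 'v set" where
  "fixed_space g = {v. g v = v}"

definition is_reflection :: "('k::field_char_0 \<Rightarrow> 'v::ab_group_add \<Rightarrow> 'v) \<Rightarrow> ('v \<Rightarrow> 'v) \<Rightarrow> bool" where
  "is_reflection sV s \<longleftrightarrow> s \<in> carrier (GL sV) \<and> (\<exists>n>0. s ^^ n = id) \<and>
     vector_space.dim sV (fixed_space s) + 1 = vector_space.dim sV UNIV"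

definition finite_reflection_group ::
    "('k::field_char_0 \<Rightarrow> 'v::ab_group_add \<Rightarrow> 'v) \<Rightarrow> ('v \<Rightarrow> 'v) set \<Rightarrow> bool" where
  "finite_reflection_group sV G \<longleftrightarrow> subgroup G (GL sV) \<and> finite G \<and>
     G = generate (GL sV) {s \<in> G. is_reflection sV s}"

definition irreducible_group ::
    "('k::field_char_0 \<Rightarrow> 'v::ab_group_add \<Rightarrow> 'v) \<Rightarrow> ('v \<Rightarrow> 'v) set \<Rightarrow> bool" where
  "irreducible_group sV G \<longleftrightarrow> (UNIV :: 'v set) \<noteq> {0} \<and>
     (\<forall>U. module.subspace sV U \<and> (\<forall>g\<in>G. g ` U \<subseteq> U) \<longrightarrow> U = {0} \<or> U = UNIV)"

definition well_generated ::
    "('k::field_char_0 \<Rightarrow> 'v::ab_group_add \<Rightarrow> 'v) \<Rightarrow> ('v \<Rightarrow> 'v) set \<Rightarrow> bool" where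
  "well_generated sV G \<longleftrightarrow> (\<exists>S. finite S \<and> card S = vector_space.dim sV UNIV \<and>
     (\<forall>s\<in>S. is_reflection sV s) \<and> G = generate (GL sV) S)"

definition distinguished_reflection ::
    "('k::field_char_0 \<Rightarrow> complex) \<Rightarrow> ('k \<Rightarrow> 'v::ab_group_add \<Rightarrow> 'v) \<Rightarrow> ('v \<Rightarrow> 'v) set \<Rightarrow> ('v \<Rightarrow> 'v) \<Rightarrow> bool"
where
  "distinguished_reflection emb sV G s \<longleftrightarrow> s \<in> G \<and> is_reflection sV s \<and>
     emb (endo_det sV s) =
       exp (2 * of_real pi * \<i> / of_nat (card {g \<in> G. \<forall>v\<in>fixed_space s. g v = v}))"


section \<open>Root systems over the ring of integers\<close>

datatype ('k, 'v, 'w) root =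
  Root (root_mod: "'v set") (coroot_mod: "'w set") (root_scalar: 'k)

definition pairing_ideal :: "('v \<Rightarrow> 'w \<Rightarrow> 'k::field_char_0) \<Rightarrow> 'v set \<Rightarrow> 'w set \<Rightarrow> 'k set" where
  "pairing_ideal pair I J = int_span (*) {pair \<alpha> \<beta> | \<alpha> \<beta>. \<alpha> \<in> I \<and> \<beta> \<in> J}"

definition is_root ::
    "('k::field_char_0 \<Rightarrow> 'v::ab_group_add \<Rightarrow> 'v) \<Rightarrow> ('k \<Rightarrow> 'w::ab_group_add \<Rightarrow> 'w) \<Rightarrow> ('v \<Rightarrow> 'w \<Rightarrow> 'k)
      \<Rightarrow> ('k, 'v, 'w) root \<Rightarrow> bool" where
  "is_root sV sW pair \<rr> \<longleftrightarrow>
     rank_one_fg_module sV (root_mod \<rr>) \<and> rank_one_fg_module sW (coroot_mod \<rr>) \<and>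
     root_scalar \<rr> \<noteq> 1 \<and> (\<exists>n>0. root_scalar \<rr> ^ n = 1) \<and>
     pairing_ideal pair (root_mod \<rr>) (coroot_mod \<rr>) = {(1 - root_scalar \<rr>) * c | c. c \<in> integers_of}"

definition root_reflection ::
    "('k::field_char_0 \<Rightarrow> 'v::ab_group_add \<Rightarrow> 'v) \<Rightarrow> ('k \<Rightarrow> 'w::ab_group_add \<Rightarrow> 'w) \<Rightarrow> ('v \<Rightarrow> 'w \<Rightarrow> 'k)
      \<Rightarrow> ('k, 'v, 'w) root \<Rightarrow> 'v \<Rightarrow> 'v" where
  "root_reflection sV sW pair \<rr> = (THE s. \<exists>v\<in>module.span sV (root_mod \<rr>).
     \<exists>w\<in>module.span sW (coroot_mod \<rr>). pair v w = 1 - root_scalar \<rr> \<and>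
       s = (\<lambda>x. x - sV (pair x w) v))"

definition contragredient ::
    "('k::field_char_0 \<Rightarrow> 'w::ab_group_add \<Rightarrow> 'w) \<Rightarrow> ('v \<Rightarrow> 'w \<Rightarrow> 'k) \<Rightarrow> ('v \<Rightarrow> 'v) \<Rightarrow> 'w \<Rightarrow> 'w" where
  "contragredient sW pair g =
     (THE h. h \<in> carrier (GL sW) \<and> (\<forall>v w. pair (g v) (h w) = pair v w))"

definition act_root ::
    "('k::field_char_0 \<Rightarrow> 'w::ab_group_add \<Rightarrow> 'w) \<Rightarrow> ('v \<Rightarrow> 'w \<Rightarrow> 'k) \<Rightarrow> ('v \<Rightarrow> 'v)
      \<Rightarrow> ('k, 'v, 'w) root \<Rightarrow> ('k, 'v, 'w) root" where
  "act_root sW pair g \<rr> =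
     Root (g ` root_mod \<rr>) (contragredient sW pair g ` coroot_mod \<rr>) (root_scalar \<rr>)"

definition root_system ::
    "('k::field_char_0 \<Rightarrow> 'v::ab_group_add \<Rightarrow> 'v) \<Rightarrow> ('k \<Rightarrow> 'w::ab_group_add \<Rightarrow> 'w) \<Rightarrow> ('v \<Rightarrow> 'w \<Rightarrow> 'k)
      \<Rightarrow> ('k, 'v, 'w) root set \<Rightarrow> bool" where
  "root_system sV sW pair R \<longleftrightarrow>
     finite R \<and> (\<forall>\<rr>\<in>R. is_root sV sW pair \<rr>) \<and>
     module.span sV (\<Union>\<rr>\<in>R. root_mod \<rr>) = UNIV \<and>
     (\<forall>\<rr>\<in>R. act_root sW pair (root_reflection sV sW pair \<rr>) ` R = R) \<and>
     (\<forall>\<rr>1\<in>R. \<forall>\<rr>2\<in>R. pairing_ideal pair (root_mod \<rr>1) (coroot_mod \<rr>2) \<subseteq> integers_of)"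

definition root_system_group ::
    "('k::field_char_0 \<Rightarrow> 'v::ab_group_add \<Rightarrow> 'v) \<Rightarrow> ('k \<Rightarrow> 'w::ab_group_add \<Rightarrow> 'w) \<Rightarrow> ('v \<Rightarrow> 'w \<Rightarrow> 'k)
      \<Rightarrow> ('k, 'v, 'w) root set \<Rightarrow> ('v \<Rightarrow> 'v) set" where
  "root_system_group sV sW pair R = generate (GL sV) (root_reflection sV sW pair ` R)"

definition distinguished_root_system ::
    "('k::field_char_0 \<Rightarrow> complex) \<Rightarrow> ('k \<Rightarrow> 'v::ab_group_add \<Rightarrow> 'v) \<Rightarrow> ('k \<Rightarrow> 'w::ab_group_add \<Rightarrow> 'w)
      \<Rightarrow> ('v \<Rightarrow> 'w \<Rightarrow> 'k) \<Rightarrow> ('k, 'v, 'w) root set \<Rightarrow> bool" where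
  "distinguished_root_system emb sV sW pair R \<longleftrightarrow>
     root_system sV sW pair R \<and> inj_on (root_reflection sV sW pair) R \<and>
     (\<forall>\<rr>\<in>R. distinguished_reflection emb sV (root_system_group sV sW pair R)
       (root_reflection sV sW pair \<rr>))"

definition root_lattice ::
    "('k::field_char_0 \<Rightarrow> 'v::ab_group_add \<Rightarrow> 'v) \<Rightarrow> ('k, 'v, 'w) root set \<Rightarrow> 'v set" where
  "root_lattice sV R = int_span sV (\<Union>\<rr>\<in>R. root_mod \<rr>)"

definition coroot_lattice ::
    "('k::field_char_0 \<Rightarrow> 'w::ab_group_add \<Rightarrow> 'w) \<Rightarrow> ('k, 'v, 'w) root set \<Rightarrow> 'w set" where
  "coroot_lattice sW R = int_span sW (\<Union>\<rr>\<in>R. coroot_mod \<rr>)"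

definition weight_lattice ::
    "('k::field_char_0 \<Rightarrow> 'w::ab_group_add \<Rightarrow> 'w) \<Rightarrow> ('v \<Rightarrow> 'w \<Rightarrow> 'k) \<Rightarrow> ('k, 'v, 'w) root set \<Rightarrow> 'v set"
where
  "weight_lattice sW pair R = {x. \<forall>y\<in>coroot_lattice sW R. pair x y \<in> integers_of}"

text \<open>
  For finitely generated modules \<open>Q \<subseteq> P\<close> that both span \<open>V\<close>, the top exterior powers are invertible
  modules, so the ideal below exists and is unique.
\<close>

definition char_ideal ::
    "('k::field_char_0 \<Rightarrow> 'v::ab_group_add \<Rightarrow> 'v) \<Rightarrow> 'v set \<Rightarrow> 'v set \<Rightarrow> 'k set" where
  "char_ideal sV P Q = (let r = vector_space.dim sV UNIV in
     THE \<aa>. int_ideal \<aa> \<and> exterior_power sV r Q = ideal_times scale_fun \<aa> (exterior_power sV r P))"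

definition connection_index ::
    "('k::field_char_0 \<Rightarrow> 'v::ab_group_add \<Rightarrow> 'v) \<Rightarrow> ('k \<Rightarrow> 'w::ab_group_add \<Rightarrow> 'w) \<Rightarrow> ('v \<Rightarrow> 'w \<Rightarrow> 'k)
      \<Rightarrow> ('k, 'v, 'w) root set \<Rightarrow> 'k set" where
  "connection_index sV sW pair R = char_ideal sV (weight_lattice sW pair R) (root_lattice sV R)"

end

theory Submission
  imports Defs "HOL-Combinatorics.Permutations"
begin

text \<open>
  Every reflection in \<open>G\<close> is a power of the reflection of a root with the same hyperplane, so \<open>G\<close>
  is generated by a set \<open>T\<close> of \<open>dim V\<close> distinguished reflections, which is the same for both root
  systems, and the roots of the elements of \<open>T\<close> represent all roots up to conjugation. For \<open>x \<in> V\<close> and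
  \<open>t \<in> T\<close> with root \<open>(I, J, \<zeta>)\<close>, the vector \<open>x - t x\<close> lies in \<open>I\<close> if and only if \<open>x\<close> pairs
  integrally with \<open>J\<close>. Hence \<open>\<phi> = (\<Sum>t\<in>T. 1 - t)\<close> maps the weight lattice onto the root lattice, and
  the connection index is generated by the determinant of \<open>\<phi>\<close>, which only depends on \<open>T\<close>.
\<close>

section \<open>Modules over the ring of integers\<close>

text \<open>Irreducibility turns the at most dim V elements of \<open>T\<close> into coordinates.
  Writing t x = x - <x, w_t> v_t, the v_t span V because their span is G-stable, so they form a
  basis, and only 0 is orthogonal to every w_t. Hence the coordinates of \<open>\<phi> x\<close> are
  the numbers <x, w_t>, the integrality conditions for different t decouple, and
  \<open>\<phi>\<close> is bijective. Both lattices are defined by all roots; they can be cut down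
  to the roots of \<open>T\<close> because the lattices defined by these roots alone are already
  G-stable. The obstacle is that I, J and the lattices need not be free over the integers of k, so
  lattice bases may not exist and the determinant has to be read off top exterior powers. What is
  left of freeness is invertibility: with I = A v and J = B w, the condition <I, J> = (1 - \<zeta>)
  puts 1 into the product of A with the conjugate of B. This one relation yields both the criterion
  for x - t x to lie in I and, multiplied over \<open>T\<close>, the cancellation of the top
  exterior power of the weight lattice, which makes the ideal in the definition unique.\<close>

lemma int_submodule_int_span: "int_submodule s (int_span s X)"
  unfolding int_span_def by (rule hull_in) (auto simp: int_submodule_def)

lemma int_span_superset: "X \<subseteq> int_span s X"
  unfolding int_span_def by (rule hull_subset)

lemma int_span_base: "x \<in> X \<Longrightarrow> x \<in> int_span s X"
  by (rule subsetD[OF int_span_superset])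

lemma int_span_minimal: "X \<subseteq> M \<Longrightarrow> int_submodule s M \<Longrightarrow> int_span s X \<subseteq> M"
  unfolding int_span_def by (rule hull_minimal)

lemma int_span_mono: "X \<subseteq> Y \<Longrightarrow> int_span s X \<subseteq> int_span s Y"
  unfolding int_span_def by (rule hull_mono)

lemma one_in_integers_of: "1 \<in> integers_of"
  by (simp add: integers_of_def)

lemma minus_one_in_integers_of: "-1 \<in> (integers_of :: 'k::field_char_0 set)"
  by (simp add: integers_of_def)

lemma int_submodule_diff:
  assumes "vector_space s" "int_submodule s M" "x \<in> M" "y \<in> M"
  shows "x - y \<in> M"
proof -
  interpret vector_space s by fact
  have "s (-1) y \<in> M"
    using assms minus_one_in_integers_of unfolding int_submodule_def by blast
  then have "x + s (-1) y \<in> M"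
    using assms unfolding int_submodule_def by blast
  then show ?thesis by simp
qed

lemma int_submodule_sum:
  assumes "int_submodule s M" "\<And>i. i \<in> A \<Longrightarrow> f i \<in> M"
  shows "sum f A \<in> M"
  using assms(2)
proof (induction A rule: infinite_finite_induct)
  case (insert i A)
  then show ?case using assms(1) unfolding int_submodule_def by simp
qed (use assms(1) in \<open>auto simp: int_submodule_def\<close>)

lemma int_submodule_INT:
  assumes "\<And>i. i \<in> A \<Longrightarrow> int_submodule s (M i)"
  shows "int_submodule s (\<Inter>i\<in>A. M i)"
  using assms unfolding int_submodule_def by auto

text \<open>Closure of \<open>integers_of\<close> under sums and products is carried as a
  hypothesis, here and in later lemmas, until a root is at hand to supply it.\<close>

lemma integers_prod:
  assumes "int_submodule (*) (integers_of :: 'k::field_char_0 set)" "\<And>i. i \<in> A \<Longrightarrow> f i \<in> integers_of"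
  shows "prod f A \<in> (integers_of :: 'k set)"
  using assms(2)
proof (induction A rule: infinite_finite_induct)
  case (insert i A)
  then show ?case using assms(1) unfolding int_submodule_def by simp
qed (simp_all add: one_in_integers_of)

lemma int_submodule_vimage:
  fixes f :: "'m::ab_group_add \<Rightarrow> 'n::ab_group_add"
  assumes "int_submodule s2 M" "\<And>x y. f (x + y) = f x + f y" "\<And>c x. f (s1 c x) = s2 c (f x)"
  shows "int_submodule s1 {x. f x \<in> M}"
proof -
  have "f 0 = 0" using assms(2)[of 0 0] by simp
  then show ?thesis using assms unfolding int_submodule_def by auto
qed

text \<open>A finite product of relations \<open>1 \<in> int_span (X i)\<close>, without multiplying out sums.\<close>

lemma int_submodule_prod_mem:
  fixes X :: "'i \<Rightarrow> 'k::field_char_0 set"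
  assumes "finite A" "int_submodule (*) T" "\<And>i. i \<in> A \<Longrightarrow> 1 \<in> int_span (*) (X i)"
    and "\<And>c. (\<And>i. i \<in> A \<Longrightarrow> c i \<in> X i) \<Longrightarrow> d * prod c A \<in> T"
  shows "d \<in> T"
  using assms(1,3,4)
proof (induction A arbitrary: d rule: finite_induct)
  case empty
  then show ?case by simp
next
  case (insert i A)
  have "d * y \<in> T" if y: "y \<in> X i" for y
  proof (rule insert.IH)
    show "1 \<in> int_span (*) (X j)" if "j \<in> A" for j
      using insert.prems that by blast
    fix c assume c: "\<And>j. j \<in> A \<Longrightarrow> c j \<in> X j"
    have "d * prod (c(i := y)) (insert i A) \<in> T"
      using c y by (intro insert.prems) auto
    moreover have "prod (c(i := y)) A = prod c A"
      using insert.hyps by (intro prod.cong) auto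
    ultimately show "d * y * prod c A \<in> T"
      using insert.hyps by (simp add: mult.assoc)
  qed
  then have "X i \<subseteq> {y. d * y \<in> T}" by blast
  moreover have "int_submodule (*) {y. d * y \<in> T}"
    by (rule int_submodule_vimage[OF assms(2)]) (simp_all add: algebra_simps)
  ultimately have "int_span (*) (X i) \<subseteq> {y. d * y \<in> T}"
    by (rule int_span_minimal)
  then show ?case using insert.prems(1)[of i] by auto
qed


section \<open>Alternating forms of top degree\<close>

lemma vector_space_mult: "vector_space ((*) :: 'k::field \<Rightarrow> 'k \<Rightarrow> 'k)"
  by unfold_locales (simp_all add: algebra_simps)

lemma linear_functional_iff:
  fixes s :: "'k::field \<Rightarrow> 'v::ab_group_add \<Rightarrow> 'v"
  shows "Vector_Spaces.linear s (*) f \<longleftrightarrow>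
    vector_space s \<and> (\<forall>x y. f (x + y) = f x + f y) \<and> (\<forall>c x. f (s c x) = c * f x)"
  by (auto simp: Vector_Spaces.linear_iff vector_space_mult)

lemma alternating_form_linear:
  assumes "alternating_form s n \<omega>" "length xs = n" "i < n"
  shows "Vector_Spaces.linear s (*) (\<lambda>x. \<omega> (xs[i := x]))"
  using assms unfolding alternating_form_def by blast

lemma alternating_form_eq:
  assumes "alternating_form s n \<omega>" "length xs = n" "i < n" "j < n" "i \<noteq> j" "xs ! i = xs ! j"
  shows "\<omega> xs = 0"
  using assms unfolding alternating_form_def by blast

text \<open>Polarization: put the sum of the two entries into both slots and expand.\<close>

lemma alternating_form_swap:
  assumes \<omega>: "alternating_form s n \<omega>" and n: "length xs = n" "i < n" "j < n" "i \<noteq> j"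
  shows "\<omega> (xs[i := xs ! j, j := xs ! i]) = - \<omega> xs"
proof -
  define g where "g a b = \<omega> (xs[i := a, j := b])" for a b
  have add2: "g a (b + c) = g a b + g a c" for a b c
    using alternating_form_linear[OF \<omega>, of "xs[i := a]" j] n
    unfolding g_def linear_functional_iff by simp
  have add1: "g (a + b) c = g a c + g b c" for a b c
    using alternating_form_linear[OF \<omega>, of "xs[j := c]" i] n
    unfolding g_def linear_functional_iff by (simp add: list_update_swap)
  have diag: "g a a = 0" for a
    unfolding g_def by (rule alternating_form_eq[OF \<omega>, of _ i j]) (use n in auto)
  have "g (xs ! i + xs ! j) (xs ! i + xs ! j) = g (xs ! i) (xs ! j) + g (xs ! j) (xs ! i)"
    unfolding add1 add2 by (simp add: diag)
  then have "g (xs ! i) (xs ! j) + g (xs ! j) (xs ! i) = 0"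
    by (simp only: diag)
  then show ?thesis
    using n by (simp add: g_def eq_neg_iff_add_eq_0 add.commute)
qed

text \<open>Two inductions. \<open>sorted\<close> treats lists with entries from \<open>bs\<close>
  as a selection sort: the common prefix with \<open>bs\<close> grows by swaps, each costing a sign.
  \<open>ext\<close> then frees the first \<open>k\<close> slots one at a time by linearity, since
  \<open>bs\<close> spans.\<close>

lemma alternating_form_eq_0_on_spanning_list:
  assumes "vector_space s" and sp: "module.span s (set bs) = UNIV"
    and \<omega>: "alternating_form s (length bs) \<omega>" and "\<omega> bs = 0" and "length xs = length bs"
  shows "\<omega> xs = 0"
proof -
  interpret vector_space s by fact
  let ?n = "length bs"
  have sorted: "\<omega> xs = 0"
    if "k \<le> ?n" "length xs = ?n" "set xs \<subseteq> set bs" "take k xs = take k bs" for k xs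
    using that
  proof (induction k arbitrary: xs rule: inc_induct)
    case base
    then show ?case using \<open>\<omega> bs = 0\<close> by simp
  next
    case (step k)
    show ?case
    proof (cases "distinct xs")
      case False
      then show ?thesis
        using alternating_form_eq[OF \<omega> step.prems(1)] step.prems(1)
        by (auto simp: distinct_conv_nth)
    next
      case True
      then have card: "card (set xs) = ?n" using step.prems by (simp add: distinct_card)
      \<comment> \<open>As many distinct entries as \<open>bs\<close> has positions force
        \<open>bs\<close> itself to be distinct and \<open>xs\<close> to be a rearrangement of
        it.\<close>
      then have "card (set bs) = ?n"
        using card_mono[OF _ step.prems(2)] card_length[of bs] by simp
      then have bs: "distinct bs" and eq: "set xs = set bs"
        using card card_distinct card_subset_eq[OF _ step.prems(2)] by auto
      have k: "k < ?n" using step.hyps by simp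
      then have "bs ! k \<in> set xs" using eq by simp
      then obtain j where j: "j < ?n" "xs ! j = bs ! k"
        using step.prems(1) by (auto simp: in_set_conv_nth)
      have le: "k \<le> j"
      proof (rule ccontr)
        assume "\<not> k \<le> j"
        then have "xs ! j = bs ! j" by (metis step.prems(3) nth_take not_le)
        then show False using j k bs \<open>\<not> k \<le> j\<close> by (simp add: nth_eq_iff_index_eq)
      qed
      show ?thesis
      proof (cases "j = k")
        case True
        then have "take (Suc k) xs = take (Suc k) bs"
          using j k step.prems by (simp add: take_Suc_conv_app_nth)
        then show ?thesis using step.IH step.prems by simp
      next
        case False
        \<comment> \<open>As \<open>j\<close> lies beyond the sorted prefix, the swap leaves that
          prefix alone and lengthens it by one.\<close>
        let ?ys = "xs[k := xs ! j, j := xs ! k]"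
        have "take (Suc k) ?ys = take (Suc k) bs"
          using j k le False step.prems by (simp add: take_Suc_conv_app_nth)
        moreover have "set ?ys \<subseteq> set bs"
          using k j(1) step.prems(1,2) set_swap[of k xs j] by auto
        ultimately have "\<omega> ?ys = 0"
          using step.IH[of ?ys] step.prems by simp
        then show ?thesis
          using alternating_form_swap[OF \<omega> step.prems(1) k j(1)] False by simp
      qed
    qed
  qed
  have ext: "\<omega> xs = 0" if "k \<le> ?n" "length xs = ?n" "\<forall>i. k \<le> i \<and> i < ?n \<longrightarrow> xs ! i \<in> set bs" for k xs
    using that
  proof (induction k arbitrary: xs)
    case 0
    then have "set xs \<subseteq> set bs" by (auto simp: in_set_conv_nth)
    then show ?case using sorted[of 0 xs] 0 by simp
  next
    case (Suc k)
    have "\<omega> (xs[k := x]) = 0" for x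
    proof (rule module_hom.eq_0_on_span[of s "(*)" "\<lambda>x. \<omega> (xs[k := x])" "set bs"])
      show "module_hom s (*) (\<lambda>x. \<omega> (xs[k := x]))"
        using alternating_form_linear[OF \<omega> Suc.prems(2), of k] Suc.prems(1)
        by (simp add: module_hom_iff_linear)
      show "\<omega> (xs[k := b]) = 0" if "b \<in> set bs" for b
      proof (rule Suc.IH)
        show "\<forall>i. k \<le> i \<and> i < ?n \<longrightarrow> xs[k := b] ! i \<in> set bs"
          using that Suc.prems by (metis Suc_leI le_neq_implies_less nth_list_update_eq nth_list_update_neq)
      qed (use Suc.prems in auto)
    qed (use sp in simp)
    from this[of "xs ! k"] show ?case by simp
  qed
  show ?thesis by (rule ext[of ?n]) (auto simp: assms(5))
qed

text \<open>The difference of both sides is alternating and vanishes at \<open>bs\<close>, so the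
  space of top-degree forms is a line.\<close>

lemma alternating_form_unique:
  assumes "vector_space s" "module.span s (set bs) = UNIV" "length bs = n"
    and \<omega>0: "alternating_form s n \<omega>0" and \<omega>: "alternating_form s n \<omega>"
    and "\<omega>0 bs = 1" and "length xs = n"
  shows "\<omega> xs = \<omega>0 xs * \<omega> bs"
proof -
  have "alternating_form s n (\<lambda>xs. \<omega> xs - \<omega>0 xs * \<omega> bs)"
    unfolding alternating_form_def
  proof (intro allI impI conjI)
    fix xs :: "'b list" and i assume "length xs = n" "i < n"
    then show "Vector_Spaces.linear s (*) (\<lambda>x. \<omega> (xs[i := x]) - \<omega>0 (xs[i := x]) * \<omega> bs)"
      using alternating_form_linear[OF \<omega>0, of xs i] alternating_form_linear[OF \<omega>, of xs i]
      by (simp add: linear_functional_iff algebra_simps)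
  next
    fix xs :: "'b list" and i j assume "length xs = n" "i < n" "j < n" "i \<noteq> j \<and> xs ! i = xs ! j"
    then show "\<omega> xs - \<omega>0 xs * \<omega> bs = 0"
      using alternating_form_eq[OF \<omega>0, of xs i j] alternating_form_eq[OF \<omega>, of xs i j] by simp
  qed
  then have "\<omega> xs - \<omega>0 xs * \<omega> bs = 0"
    using alternating_form_eq_0_on_spanning_list[OF assms(1,2), of "\<lambda>xs. \<omega> xs - \<omega>0 xs * \<omega> bs" xs] assms
    by simp
  then show ?thesis by simp
qed

text \<open>Leibniz formula for the determinant of the matrix with entries
  \<open>f j (xs ! i)\<close>; as a form in \<open>xs\<close> it is the exterior product of the
  functionals \<open>f 0\<close>, ..., \<open>f (n - 1)\<close>.\<close>

definition detform :: "nat \<Rightarrow> (nat \<Rightarrow> 'v \<Rightarrow> 'k::field_char_0) \<Rightarrow> 'v list \<Rightarrow> 'k" where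
  "detform n f xs = (\<Sum>p | p permutes {..<n}. of_int (sign p) * (\<Prod>i<n. f (p i) (xs ! i)))"

text \<open>Each summand contains the \<open>i\<close>-th entry in exactly one factor, which gives
  linearity. With two equal entries, composing all permutations with the transposition shows that
  the sum equals its own negative, hence is 0 in characteristic 0.\<close>

lemma alternating_form_detform:
  assumes V: "vector_space s" and f: "\<And>j. j < n \<Longrightarrow> Vector_Spaces.linear s (*) (f j)"
  shows "alternating_form s n (detform n f)"
  unfolding alternating_form_def
proof (intro allI impI conjI)
  fix xs :: "'b list" and i assume xs: "length xs = n" "i < n"
  have split: "detform n f (xs[i := x]) = (\<Sum>p | p permutes {..<n}.
      of_int (sign p) * (f (p i) x * (\<Prod>m\<in>{..<n} - {i}. f (p m) (xs ! m))))" for x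
    unfolding detform_def
  proof (rule sum.cong[OF refl])
    fix p
    have "(\<Prod>m<n. f (p m) (xs[i := x] ! m)) =
        f (p i) x * (\<Prod>m\<in>{..<n} - {i}. f (p m) (xs[i := x] ! m))"
      using xs by (subst prod.remove[of _ i]) auto
    also have "(\<Prod>m\<in>{..<n} - {i}. f (p m) (xs[i := x] ! m)) = (\<Prod>m\<in>{..<n} - {i}. f (p m) (xs ! m))"
      by (rule prod.cong) auto
    finally show "of_int (sign p) * (\<Prod>m<n. f (p m) (xs[i := x] ! m)) =
        of_int (sign p) * (f (p i) x * (\<Prod>m\<in>{..<n} - {i}. f (p m) (xs ! m)))"
      by simp
  qed
  have lin: "Vector_Spaces.linear s (*) (f (p i))" if "p permutes {..<n}" for p
    using f that xs permutes_in_image[OF that, of i] by simp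
  show "Vector_Spaces.linear s (*) (\<lambda>x. detform n f (xs[i := x]))"
    unfolding linear_functional_iff split
    using lin V
    by (auto simp: linear_functional_iff sum_distrib_left sum.distrib[symmetric] algebra_simps intro!: sum.cong)
next
  fix xs :: "'b list" and i j
  assume xs: "length xs = n" "i < n" "j < n" "i \<noteq> j \<and> xs ! i = xs ! j"
  let ?\<tau> = "transpose i j"
  have \<tau>: "?\<tau> permutes {..<n}" using xs by (simp add: permutes_swap_id)
  have "detform n f xs = (\<Sum>p | p permutes {..<n}.
      of_int (sign (p \<circ> ?\<tau>)) * (\<Prod>m<n. f ((p \<circ> ?\<tau>) m) (xs ! m)))"
    unfolding detform_def by (rule sum_permutations_compose_right[OF \<tau>])
  also have "\<dots> = (\<Sum>p | p permutes {..<n}. - (of_int (sign p) * (\<Prod>m<n. f (p m) (xs ! m))))"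
  proof (rule sum.cong[OF refl])
    fix p assume "p \<in> {p. p permutes {..<n}}"
    then have "sign (p \<circ> ?\<tau>) = - sign p"
      using xs \<tau>
      by (metis finite_lessThan mem_Collect_eq mult_minus1_right permutation_permutes sign_compose sign_swap_id)
    moreover have "(\<Prod>m<n. f ((p \<circ> ?\<tau>) m) (xs ! m)) = (\<Prod>m<n. f (p (?\<tau> m)) (xs ! (?\<tau> m)))"
      using xs by (intro prod.cong) (auto simp: transpose_def)
    moreover have "\<dots> = (\<Prod>m<n. f (p m) (xs ! m))"
      using \<tau> by (intro prod.reindex_bij_betw[of ?\<tau>] permutes_imp_bij)
    ultimately show "of_int (sign (p \<circ> ?\<tau>)) * (\<Prod>m<n. f ((p \<circ> ?\<tau>) m) (xs ! m)) =
        - (of_int (sign p) * (\<Prod>m<n. f (p m) (xs ! m)))"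
      by simp
  qed
  also have "\<dots> = - detform n f xs" by (simp add: detform_def sum_negf)
  finally show "detform n f xs = 0" by simp
qed

text \<open>A permutation other than the identity moves some index and so picks up an off-diagonal
  entry.\<close>

lemma detform_diagonal:
  assumes "\<And>i j. i < n \<Longrightarrow> j < n \<Longrightarrow> i \<noteq> j \<Longrightarrow> f j (xs ! i) = 0"
  shows "detform n f xs = (\<Prod>i<n. f i (xs ! i))"
proof -
  have "of_int (sign p) * (\<Prod>i<n. f (p i) (xs ! i)) = 0" if p: "p permutes {..<n}" "p \<noteq> id" for p
  proof -
    obtain i where i: "p i \<noteq> i" using p(2) by (auto simp: fun_eq_iff)
    then have "i < n" using p(1) by (meson lessThan_iff permutes_not_in)
    moreover have "p i < n" using p(1) \<open>i < n\<close> permutes_in_image by fastforce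
    ultimately have "\<exists>i\<in>{..<n}. f (p i) (xs ! i) = 0" using assms i by (metis lessThan_iff)
    then show ?thesis by (simp add: prod_zero)
  qed
  then have "detform n f xs = (\<Sum>p\<in>{id}. of_int (sign p) * (\<Prod>i<n. f (p i) (xs ! i)))"
    unfolding detform_def
    by (intro sum.mono_neutral_right) (auto simp: finite_permutations permutes_id)
  then show ?thesis by simp
qed

lemma detform_integral:
  assumes Z: "int_submodule (*) (integers_of :: 'k::field_char_0 set)"
    and "\<And>i j. i < n \<Longrightarrow> j < n \<Longrightarrow> f j (xs ! i) \<in> (integers_of :: 'k set)"
  shows "detform n f xs \<in> integers_of"
  unfolding detform_def
proof (rule int_submodule_sum[OF Z])
  fix p assume "p \<in> {p. p permutes {..<n}}"
  then have p: "\<And>i. i < n \<Longrightarrow> p i < n"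
    by (metis lessThan_iff mem_Collect_eq permutes_in_image)
  have "(\<Prod>i<n. f (p i) (xs ! i)) \<in> integers_of"
    using assms p by (intro integers_prod[OF Z]) auto
  moreover have "of_int (sign p) \<in> (integers_of :: 'k set)"
    by (simp add: integers_of_def)
  ultimately show "of_int (sign p) * (\<Prod>i<n. f (p i) (xs ! i)) \<in> integers_of"
    using Z unfolding int_submodule_def by blast
qed

section \<open>Reflecting hyperplanes\<close>

locale char_0_space = vector_space s
  for s :: "'k::field_char_0 \<Rightarrow> 'v::ab_group_add \<Rightarrow> 'v"
begin

lemma linear_functionalD:
  assumes "Vector_Spaces.linear s ((*) :: 'k \<Rightarrow> 'k \<Rightarrow> 'k) f"
  shows "f 0 = 0" "f (x + y) = f x + f y" "f (x - y) = f x - f y" "f (s c x) = c * f x"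
proof -
  interpret f: Vector_Spaces.linear s "(*)" f by fact
  show "f 0 = 0" "f (x + y) = f x + f y" "f (x - y) = f x - f y" "f (s c x) = c * f x"
    by (simp_all add: f.zero f.add f.diff f.scale)
qed

lemma linear_mapD:
  assumes "Vector_Spaces.linear s s f"
  shows "f 0 = 0" "f (x + y) = f x + f y" "f (x - y) = f x - f y" "f (s c x) = s c (f x)"
proof -
  interpret f: Vector_Spaces.linear s s f by fact
  show "f 0 = 0" "f (x + y) = f x + f y" "f (x - y) = f x - f y" "f (s c x) = s c (f x)"
    by (simp_all add: f.zero f.add f.diff f.scale)
qed

lemma linear_mapI:
  assumes "\<And>x y. f (x + y) = f x + f y" "\<And>c x. f (s c x) = s c (f x)"
  shows "Vector_Spaces.linear s s f"
  using assms vector_space_axioms by (simp add: Vector_Spaces.linear_iff)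

text \<open>Subtracting \<open>f x / f x0\<close> times \<open>x0\<close> from \<open>x\<close>
  lands in the kernel of \<open>f\<close>; this gives the factor \<open>g x0 / f x0\<close>.\<close>

lemma functional_eq_scaled:
  assumes f: "Vector_Spaces.linear s ((*) :: 'k \<Rightarrow> 'k \<Rightarrow> 'k) f"
    and g: "Vector_Spaces.linear s ((*) :: 'k \<Rightarrow> 'k \<Rightarrow> 'k) g"
    and ker: "{x. f x = 0} \<subseteq> {x. g x = 0}" and "f x0 \<noteq> 0"
  shows "\<exists>c. \<forall>x. g x = c * f x"
proof (intro exI allI)
  fix x
  have "f (x - s (f x / f x0) x0) = 0"
    using \<open>f x0 \<noteq> 0\<close> by (simp add: linear_functionalD[OF f])
  then have "g (x - s (f x / f x0) x0) = 0" using ker by blast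
  then show "g x = g x0 / f x0 * f x"
    using \<open>f x0 \<noteq> 0\<close> by (simp add: linear_functionalD[OF g] field_simps)
qed

text \<open>Kernels of nonzero functionals rather than subspaces of codimension one: the arguments
  below multiply and compare these functionals. \<open>hyperplane_if_dim\<close> links this to the
  dimension count in \<open>is_reflection\<close>.\<close>

definition hyperplane :: "'v set \<Rightarrow> bool" where
  "hyperplane H \<longleftrightarrow> (\<exists>f. Vector_Spaces.linear s ((*) :: 'k \<Rightarrow> 'k \<Rightarrow> 'k) f \<and> (\<exists>x. f x \<noteq> 0) \<and> H = {x. f x = 0})"

lemma subspace_hyperplane: "hyperplane H \<Longrightarrow> subspace H"
  by (auto simp: hyperplane_def subspace_def linear_functionalD)

lemma hyperplane_subset_eq:
  assumes "hyperplane H" "hyperplane K" "H \<subseteq> K"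
  shows "H = K"
proof -
  obtain f x0 where f: "Vector_Spaces.linear s (*) f" "f x0 \<noteq> 0" "H = {x. f x = 0}"
    using assms(1) unfolding hyperplane_def by blast
  obtain g x1 where g: "Vector_Spaces.linear s (*) g" "g x1 \<noteq> 0" "K = {x. g x = 0}"
    using assms(2) unfolding hyperplane_def by blast
  obtain c where c: "\<And>x. g x = c * f x"
    using functional_eq_scaled[OF f(1) g(1) _ f(2)] assms(3) f(3) g(3) by blast
  then have "c \<noteq> 0" using g(2) by auto
  then show ?thesis using c f(3) g(3) by simp
qed

lemma hyperplane_image:
  assumes g: "Vector_Spaces.linear s s g" "bij g" and H: "hyperplane H"
  shows "hyperplane (g ` H)"
proof -
  obtain f x0 where f: "Vector_Spaces.linear s (*) f" "f x0 \<noteq> 0" "H = {x. f x = 0}"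
    using H unfolding hyperplane_def by blast
  have inv: "inv_into UNIV g (g x) = x" "g (inv_into UNIV g x) = x" for x
    using g(2) by (simp_all add: bij_is_inj bij_is_surj surj_f_inv_f)
  have "inv_into UNIV g (x + y) = inv_into UNIV g x + inv_into UNIV g y" for x y
    by (metis inv linear_mapD(2)[OF g(1)])
  moreover have "inv_into UNIV g (s c x) = s c (inv_into UNIV g x)" for c x
    by (metis inv linear_mapD(4)[OF g(1)])
  ultimately have "Vector_Spaces.linear s (*) (\<lambda>x. f (inv_into UNIV g x))"
    by (simp add: linear_functional_iff vector_space_axioms linear_functionalD[OF f(1)])
  moreover have "f (inv_into UNIV g (g x0)) \<noteq> 0" using f(2) inv by simp
  moreover have "g ` H = {x. f (inv_into UNIV g x) = 0}"
    using f(3) inv by (auto simp: image_iff) (metis inv(2))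
  ultimately show ?thesis unfolding hyperplane_def by blast
qed

lemma funpow_transvection:
  assumes g: "Vector_Spaces.linear s s g" and fixed: "g (g x - x) = g x - x"
  shows "(g ^^ m) x = x + s (of_nat m) (g x - x)"
proof (induction m)
  case (Suc m)
  have "(g ^^ Suc m) x = g x + s (of_nat m) (g (g x - x))"
    by (simp add: Suc linear_mapD[OF g])
  then show ?case unfolding fixed by (simp add: algebra_simps)
qed simp

text \<open>The powers of \<open>g\<close> move \<open>x\<close> by multiples of the fixed vector
  \<open>g x - x\<close>, and in characteristic 0 no positive multiple of a nonzero vector vanishes.
  This takes the place of semisimplicity in what follows.\<close>

lemma transvection_finite_order:
  assumes "m > 0" and "Vector_Spaces.linear s s g" "g (g x - x) = g x - x" "g ^^ m = id"
  shows "g x = x"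
proof -
  have "x + s (of_nat m) (g x - x) = x"
    using funpow_transvection[OF assms(2,3), of m] assms(4) by simp
  then have "s (of_nat m) (g x - x) = 0" by simp
  then show ?thesis using \<open>m > 0\<close> by simp
qed


text \<open>A vector space over an infinite field is not a finite union of proper subspaces. On the
  line \<open>x + s c y\<close> every form vanishes for at most one \<open>c\<close>: the old forms
  are nonzero at \<open>x\<close>, the new one has nonzero slope along \<open>y\<close>.\<close>

lemma ex_common_nonzero:
  assumes "finite A" "subspace K" "\<And>i. i \<in> A \<Longrightarrow> Vector_Spaces.linear s (*) (f i)"
    and "\<And>i. i \<in> A \<Longrightarrow> \<exists>x\<in>K. f i x \<noteq> 0"
  shows "\<exists>x\<in>K. \<forall>i\<in>A. f i x \<noteq> 0"
  using assms(1,3,4)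
proof (induction A rule: finite_induct)
  case empty
  then show ?case using subspace_0[OF assms(2)] by blast
next
  case (insert j A)
  obtain x where x: "x \<in> K" "\<And>i. i \<in> A \<Longrightarrow> f i x \<noteq> 0"
    using insert.IH insert.prems by blast
  obtain y where y: "y \<in> K" "f j y \<noteq> 0"
    using insert.prems by blast
  have lin: "f i (x + s c y) = f i x + c * f i y" if "i \<in> insert j A" for i c
    using linear_functionalD[OF insert.prems(1)[OF that]] by simp
  have "\<exists>b. {c. f i (x + s c y) = 0} \<subseteq> {b}" if i: "i \<in> insert j A" for i
  proof (cases "f i y = 0")
    case True
    then show ?thesis using lin[OF i] x(2) y(2) i by auto
  next
    case False
    then have "{c. f i (x + s c y) = 0} \<subseteq> {- f i x / f i y}"
      by (auto simp: lin[OF i] field_simps eq_neg_iff_add_eq_0)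
    then show ?thesis by blast
  qed
  then have "finite (\<Union>i\<in>insert j A. {c. f i (x + s c y) = 0})"
    using insert.hyps by (intro finite_UN_I) (auto intro: finite_subset)
  then obtain c where "c \<notin> (\<Union>i\<in>insert j A. {c. f i (x + s c y) = 0})"
    using ex_new_if_finite[OF infinite_UNIV_char_0] by blast
  then have "\<forall>i\<in>insert j A. f i (x + s c y) \<noteq> 0" by blast
  moreover have "x + s c y \<in> K"
    using x(1) y(1) assms(2) by (simp add: subspace_add subspace_scale)
  ultimately show ?case by blast
qed

text \<open>
  \<open>g\<close> scales the product of the linear forms by a constant; evaluating at a generic point of \<open>K\<close>
  shows that the constant is \<open>1\<close>.
\<close>

lemma prod_forms_invariant:
  assumes "finite \<H>"
    and f: "\<And>H. H \<in> \<H> \<Longrightarrow> Vector_Spaces.linear s (*) (f H)" "\<And>H. H \<in> \<H> \<Longrightarrow> H = {x. f H x = 0}"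
    and g: "Vector_Spaces.linear s s g" "inj g" "(`) g ` \<H> \<subseteq> \<H>"
    and K: "subspace K" "\<And>x. x \<in> K \<Longrightarrow> g x = x" "\<And>H. H \<in> \<H> \<Longrightarrow> \<not> K \<subseteq> H"
  shows "(\<Prod>H\<in>\<H>. f H (g x)) = (\<Prod>H\<in>\<H>. f H x)"
proof -
  have inj: "inj_on ((`) g) \<H>" using g(2) by (simp add: inj_on_def inj_image_eq_iff)
  then have bij: "bij_betw ((`) g) \<H> \<H>"
    using endo_inj_surj[OF assms(1) g(3)] by (simp add: bij_betw_def)
  \<comment> \<open>The form of the image hyperplane, pulled back along \<open>g\<close>, vanishes
    on \<open>H\<close> and is thus a multiple of the form of \<open>H\<close>.\<close>
  have "\<exists>c. \<forall>x. f (g ` H) (g x) = c * f H x" if H: "H \<in> \<H>" for H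
  proof -
    obtain x0 where x0: "f H x0 \<noteq> 0" using K(3)[OF H] f(2)[OF H] by blast
    have gH: "g ` H \<in> \<H>" using g(3) H by blast
    have "Vector_Spaces.linear s (*) (\<lambda>x. f (g ` H) (g x))"
      using linear_functionalD[OF f(1)[OF gH]] linear_mapD[OF g(1)]
      by (simp add: linear_functional_iff vector_space_axioms)
    moreover have "{x. f H x = 0} \<subseteq> {x. f (g ` H) (g x) = 0}"
      using f(2)[OF gH] f(2)[OF H] by blast
    ultimately show ?thesis using functional_eq_scaled[OF f(1)[OF H] _ _ x0] by blast
  qed
  then obtain c where c: "\<And>H x. H \<in> \<H> \<Longrightarrow> f (g ` H) (g x) = c H * f H x" by metis
  have eq: "(\<Prod>H\<in>\<H>. f H (g x)) = prod c \<H> * (\<Prod>H\<in>\<H>. f H x)" for x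
  proof -
    have "(\<Prod>H\<in>\<H>. f H (g x)) = (\<Prod>H\<in>\<H>. f (g ` H) (g x))"
      using prod.reindex_bij_betw[OF bij, of "\<lambda>H. f H (g x)"] by simp
    also have "\<dots> = (\<Prod>H\<in>\<H>. c H * f H x)" by (rule prod.cong) (simp_all add: c)
    finally show ?thesis by (simp add: prod.distrib)
  qed
  have "\<exists>x\<in>K. \<forall>H\<in>\<H>. f H x \<noteq> 0"
    using K(3) f(2) by (intro ex_common_nonzero[OF assms(1) K(1) f(1)]) blast+
  then obtain y where y: "y \<in> K" "\<forall>H\<in>\<H>. f H y \<noteq> 0" by blast
  then have "(\<Prod>H\<in>\<H>. f H y) \<noteq> 0" using assms(1) by simp
  then have "prod c \<H> = 1" using eq[of y] K(2)[OF y(1)] by simp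
  then show ?thesis using eq by simp
qed

section \<open>Finite subgroups of GL(V)\<close>

lemma GL_simps:
  "carrier (GL s) = {g. Vector_Spaces.linear s s g \<and> bij g}" "x \<otimes>\<^bsub>GL s\<^esub> y = x \<circ> y" "\<one>\<^bsub>GL s\<^esub> = id"
  by (simp_all add: GL_def)

lemma linear_inv:
  assumes g: "Vector_Spaces.linear s s g" "bij g"
  shows "Vector_Spaces.linear s s (inv_into UNIV g)"
proof (rule linear_mapI)
  have inv: "inv_into UNIV g (g x) = x" "g (inv_into UNIV g x) = x" for x
    using g(2) by (simp_all add: bij_is_inj bij_is_surj surj_f_inv_f)
  show "inv_into UNIV g (x + y) = inv_into UNIV g x + inv_into UNIV g y" for x y
    by (metis inv linear_mapD(2)[OF g(1)])
  show "inv_into UNIV g (s c x) = s c (inv_into UNIV g x)" for c x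
    by (metis inv linear_mapD(4)[OF g(1)])
qed

lemma group_GL: "group (GL s)"
proof (rule groupI)
  fix x assume "x \<in> carrier (GL s)"
  then show "\<exists>y\<in>carrier (GL s). y \<otimes>\<^bsub>GL s\<^esub> x = \<one>\<^bsub>GL s\<^esub>"
    unfolding GL_simps
    by (intro bexI[of _ "inv_into UNIV x"]) (auto simp: linear_inv bij_imp_bij_inv bij_is_inj)
qed (auto simp: GL_simps comp_assoc linear_id bij_comp intro: Vector_Spaces.linear_compose)

lemma subgroup_GL:
  assumes "subgroup G (GL s)"
  shows "id \<in> G" "g \<in> G \<Longrightarrow> h \<in> G \<Longrightarrow> g \<circ> h \<in> G"
    "g \<in> G \<Longrightarrow> Vector_Spaces.linear s s g" "g \<in> G \<Longrightarrow> bij g"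
    "g \<in> G \<Longrightarrow> inv_into UNIV g \<in> G"
proof -
  interpret group "GL s" by (rule group_GL)
  interpret subgroup G "GL s" by fact
  show "id \<in> G" "g \<in> G \<Longrightarrow> h \<in> G \<Longrightarrow> g \<circ> h \<in> G" using one_closed m_closed by (simp_all add: GL_simps)
  show g: "g \<in> G \<Longrightarrow> Vector_Spaces.linear s s g" "g \<in> G \<Longrightarrow> bij g" using subset by (auto simp: GL_simps)
  assume G: "g \<in> G"
  have "inv_into UNIV g \<circ> g = id" using g(2)[OF G] by (simp add: bij_is_inj)
  then have "inv\<^bsub>GL s\<^esub> g = inv_into UNIV g"
    using inv_equality[of "inv_into UNIV g" g] g[OF G] by (simp add: GL_simps linear_inv bij_imp_bij_inv)
  then show "inv_into UNIV g \<in> G" using m_inv_closed[OF G] by simp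
qed

lemma finite_order:
  assumes G: "subgroup G (GL s)" "finite G" and "g \<in> G"
  shows "\<exists>m>0. g ^^ m = id"
proof -
  have pow: "g ^^ i \<in> G" for i
    by (induction i) (simp_all only: funpow.simps subgroup_GL(1,2)[OF G(1)] assms(3))
  have "\<not> inj_on (\<lambda>i. g ^^ i) (UNIV :: nat set)"
    using pow G(2) infinite_iff_countable_subset[of G] by auto
  then obtain i j where ij: "i < j" "g ^^ i = g ^^ j"
    unfolding inj_on_def by (metis linorder_neqE_nat)
  have "bij (g ^^ i)" using subgroup_GL(4)[OF G(1) pow] .
  moreover have "g ^^ i \<circ> g ^^ (j - i) = g ^^ i \<circ> id"
    using ij funpow_add[of i "j - i" g] by simp
  ultimately have "g ^^ (j - i) = id"
    by (simp add: bij_is_inj fun_eq_iff inj_eq)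
  then show ?thesis using ij(1) by (intro exI[of _ "j - i"]) simp
qed

lemma linear_funpow:
  assumes "Vector_Spaces.linear s s g"
  shows "Vector_Spaces.linear s s (g ^^ m)"
proof (induction m)
  case (Suc m)
  then show ?case using Vector_Spaces.linear_compose[OF Suc assms] by (simp only: funpow.simps)
qed (simp only: funpow.simps linear_id)

text \<open>In a finite group the inverse of a generator is a positive power of it, so no case for
  inverses is left: \<open>G\<close> is reached from \<open>id\<close> by left multiplication with
  generators.\<close>

lemma generate_finite_induct [consumes 4, case_names id comp]:
  assumes G: "subgroup G (GL s)" "finite G" "G = generate (GL s) A" and "g \<in> G"
    and id: "P id" and comp: "\<And>a g. a \<in> A \<Longrightarrow> g \<in> G \<Longrightarrow> P g \<Longrightarrow> P (a \<circ> g)"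
  shows "P g"
proof -
  note sg = subgroup_GL[OF G(1)]
  have AG: "A \<subseteq> G" unfolding G(3) by (auto intro: generate.incl)
  have pow: "P (a ^^ m \<circ> h) \<and> a ^^ m \<circ> h \<in> G" if "a \<in> A" "h \<in> G" "P h" for a h m
  proof (induction m)
    case (Suc m)
    then have "P (a \<circ> (a ^^ m \<circ> h)) \<and> a \<circ> (a ^^ m \<circ> h) \<in> G"
      using comp[OF that(1)] sg(2)[of a] AG that(1) by blast
    then show ?case by (simp only: funpow.simps comp_assoc)
  qed (use that in \<open>simp_all only: funpow.simps id_comp\<close>)
  have gen: "P (g \<circ> h)" if "g \<in> generate (GL s) A" "h \<in> G" "P h" for g h
    using that
  proof (induction g arbitrary: h rule: generate.induct)
    case one
    then show ?case by (simp only: GL_simps id_comp)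
  next
    case (incl a)
    then show ?case by (intro comp)
  next
    case (inv a)
    then have a: "a \<in> G" using AG by blast
    obtain m where "m > 0" "a ^^ m = id" using finite_order[OF G(1,2) a] by blast
    then have "a ^^ (m - 1) \<circ> a = id"
      by (metis Suc_diff_1 funpow_Suc_right)
    moreover have "a \<in> carrier (GL s)" "a ^^ (m - 1) \<in> carrier (GL s)"
      using sg(3,4)[OF a] by (simp_all add: GL_simps linear_funpow bij_betw_funpow)
    ultimately have "inv\<^bsub>GL s\<^esub> a = a ^^ (m - 1)"
      by (intro group.inv_equality[OF group_GL]) (simp_all only: GL_simps)
    then show ?case using pow[OF inv, of "m - 1"] by (simp only:)
  next
    case (eng g1 g2)
    then have "g2 \<circ> h \<in> G" using sg(2) G(3) by blast
    then have "P (g1 \<circ> (g2 \<circ> h))" using eng by blast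
    then show ?case by (simp only: GL_simps comp_assoc)
  qed
  then have "P (g \<circ> id)" using G(3) \<open>g \<in> G\<close> sg(1) id by blast
  then show ?thesis by simp
qed

text \<open>
  If the hyperplane of no generator were in the orbit of \<open>H\<close>, the product of linear forms over that orbit would be
  \<open>G\<close>-invariant, whereas \<open>t\<close> multiplies it by a constant different from \<open>1\<close>.
\<close>

lemma hyperplane_conj_to_generator:
  assumes G: "subgroup G (GL s)" "finite G" and A: "G = generate (GL s) A"
    and hA: "\<And>a. a \<in> A \<Longrightarrow> hyperplane (fixed_space a)"
    and t: "t \<in> G" "hyperplane (fixed_space t)"
  shows "\<exists>a\<in>A. \<exists>g\<in>G. fixed_space a = g ` fixed_space t"
proof (rule ccontr)
  define H where "H = fixed_space t"
  define \<H> where "\<H> = (\<lambda>g. g ` H) ` G"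
  assume contra: "\<not> (\<exists>a\<in>A. \<exists>g\<in>G. fixed_space a = g ` fixed_space t)"
  have AG: "A \<subseteq> G" unfolding A by (auto intro: generate.incl)
  note sg = subgroup_GL[OF G(1)]
  have fin: "finite \<H>" unfolding \<H>_def using G(2) by simp
  have hyp: "hyperplane K" if "K \<in> \<H>" for K
    using that hyperplane_image sg t(2) unfolding \<H>_def H_def by blast
  have "\<exists>f. Vector_Spaces.linear s (*) f \<and> K = {x. f x = 0}" if "K \<in> \<H>" for K
    using hyp[OF that] unfolding hyperplane_def by blast
  then obtain f where f: "\<And>K. K \<in> \<H> \<Longrightarrow> Vector_Spaces.linear s (*) (f K)" "\<And>K. K \<in> \<H> \<Longrightarrow> K = {x. f K x = 0}"
    by metis
  have orbit: "(`) g ` \<H> \<subseteq> \<H>" if "g \<in> G" for g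
  proof -
    have "g ` h ` H = (g \<circ> h) ` H" for h by (simp add: image_comp)
    then show ?thesis using sg(2)[OF that] unfolding \<H>_def by blast
  qed
  define F where "F x = (\<Prod>K\<in>\<H>. f K x)" for x
  have FA: "F (a x) = F x" if a: "a \<in> A" for a x
    unfolding F_def
  proof (rule prod_forms_invariant[OF fin f])
    have "a \<in> G" using a AG by blast
    then show "Vector_Spaces.linear s s a" "inj a" "(`) a ` \<H> \<subseteq> \<H>"
      using sg orbit by (auto simp: bij_is_inj)
    show "subspace (fixed_space a)" using hA[OF a] by (rule subspace_hyperplane)
    show "\<And>x. x \<in> fixed_space a \<Longrightarrow> a x = x" by (simp add: fixed_space_def)
    show "\<not> fixed_space a \<subseteq> K" if "K \<in> \<H>" for K
      using hyperplane_subset_eq[OF hA[OF a] hyp[OF that]] contra a that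
      unfolding \<H>_def H_def by blast
  qed
  have "\<forall>x. F (t x) = F x"
    using G A t(1)
  proof (induction t rule: generate_finite_induct)
    case (comp a g)
    then show ?case using FA by simp
  qed simp
  then have Ft: "F (t x) = F x" for x by blast
  have H: "H \<in> \<H>" unfolding \<H>_def using sg(1) by (metis image_eqI image_id id_apply)
  have tH: "t ` H = H" unfolding H_def fixed_space_def by force
  \<comment> \<open>\<open>t\<close> fixes the factor \<open>H\<close> of the orbit and permutes the
    others. None of these contains \<open>H\<close>, so \<open>H\<close> itself supplies the generic
    fixed point for their product.\<close>
  have F't: "(\<Prod>K\<in>\<H> - {H}. f K (t x)) = (\<Prod>K\<in>\<H> - {H}. f K x)" for x
  proof (rule prod_forms_invariant)
    show "inj t" using sg(4)[OF t(1)] by (simp add: bij_is_inj)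
    then have "t ` K \<noteq> H" if "K \<noteq> H" for K
      using that tH inj_image_eq_iff by metis
    then show "(`) t ` (\<H> - {H}) \<subseteq> \<H> - {H}" using orbit[OF t(1)] by blast
    show "Vector_Spaces.linear s s t" using sg(3)[OF t(1)] .
    show "subspace H" using hyp[OF H] by (rule subspace_hyperplane)
    show "\<And>x. x \<in> H \<Longrightarrow> t x = x" by (simp add: H_def fixed_space_def)
    show "\<not> H \<subseteq> K" if "K \<in> \<H> - {H}" for K
      using hyperplane_subset_eq[OF hyp[OF H] hyp] that by blast
  qed (use fin f in auto)
  \<comment> \<open>A point off all hyperplanes of the orbit, so that the invariant product over the
    other hyperplanes can be cancelled.\<close>
  have "\<exists>x\<in>UNIV. \<forall>K\<in>\<H>. f K x \<noteq> 0"
  proof (rule ex_common_nonzero[OF fin _ f(1)])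
    fix K assume "K \<in> \<H>"
    then have "K \<noteq> UNIV" using hyp[of K] unfolding hyperplane_def by blast
    then show "\<exists>x\<in>UNIV. f K x \<noteq> 0" using f(2)[OF \<open>K \<in> \<H>\<close>] by blast
  qed simp_all
  then obtain x where x: "\<forall>K\<in>\<H>. f K x \<noteq> 0" by blast
  have "(\<Prod>K\<in>\<H> - {H}. f K x) \<noteq> 0" using x fin by simp
  moreover have "f H (t x) * (\<Prod>K\<in>\<H> - {H}. f K x) = f H x * (\<Prod>K\<in>\<H> - {H}. f K x)"
    using Ft[of x] F't[of x] unfolding F_def prod.remove[OF fin H] by simp
  ultimately have "f H (t x - x) = 0" by (simp add: linear_functionalD[OF f(1)[OF H]])
  \<comment> \<open>Hence \<open>t\<close> moves \<open>x\<close> by a vector that it fixes; finite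
    order forces \<open>t x = x\<close>, although \<open>x\<close> was chosen off
    \<open>H\<close>.\<close>
  then have "t x - x \<in> H" using f(2)[OF H] by blast
  then have "t (t x - x) = t x - x" by (simp add: H_def fixed_space_def)
  moreover obtain m where "m > 0" "t ^^ m = id" using finite_order[OF G t(1)] by blast
  ultimately have "t x = x"
    using transvection_finite_order[of m t x] sg(3)[OF t(1)] by simp
  then have "x \<in> H" by (simp add: H_def fixed_space_def)
  then show False using x H f(2)[OF H] by blast
qed

end

subsection \<open>The pointwise stabilizer of a hyperplane\<close>

context char_0_space
begin

definition fixes_pointwise :: "'v set \<Rightarrow> ('v \<Rightarrow> 'v) \<Rightarrow> bool" where
  "fixes_pointwise H g \<longleftrightarrow> (\<forall>x\<in>H. g x = x)"

text \<open>The scalar \<open>c\<close> is the eigenvalue of \<open>g\<close> on the line V / ker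
  f.\<close>

lemma ex_normal_scalar:
  assumes f: "Vector_Spaces.linear s (*) f" "f x0 \<noteq> 0"
    and g: "Vector_Spaces.linear s s g" "fixes_pointwise {x. f x = 0} g"
  shows "\<exists>c. \<forall>x. f (g x) = c * f x"
proof (rule functional_eq_scaled[OF f(1) _ _ f(2)])
  show "Vector_Spaces.linear s (*) (\<lambda>x. f (g x))"
    using linear_functionalD[OF f(1)] linear_mapD[OF g(1)]
    by (simp add: linear_functional_iff vector_space_axioms)
  show "{x. f x = 0} \<subseteq> {x. f (g x) = 0}" using g(2) by (auto simp: fixes_pointwise_def)
qed

text \<open>The quotient of \<open>g\<close> and \<open>h\<close> acts trivially on the hyperplane
  and on V modulo it, so it is a transvection of finite order, hence the identity.\<close>

lemma pointwise_stabilizer_inj: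
  assumes G: "subgroup G (GL s)" "finite G" and f: "Vector_Spaces.linear s (*) f" "f x0 \<noteq> 0"
    and g: "g \<in> G" "fixes_pointwise {x. f x = 0} g" "\<And>x. f (g x) = c * f x"
    and h: "h \<in> G" "fixes_pointwise {x. f x = 0} h" "\<And>x. f (h x) = c * f x"
  shows "g = h"
proof
  fix x
  note sg = subgroup_GL[OF G(1)]
  have inv: "inv_into UNIV g (g y) = y" "g (inv_into UNIV g y) = y" for y
    using sg(4)[OF g(1)] by (simp_all add: bij_is_inj bij_is_surj surj_f_inv_f)
  define k where "k = inv_into UNIV g \<circ> h"
  have k: "k \<in> G" unfolding k_def by (intro sg(2,5) g h)
  have "c \<noteq> 0" using g(3)[of "inv_into UNIV g x0"] f(2) inv by auto
  moreover have "c * f (k x) = c * f x"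
    using g(3)[of "k x"] h(3)[of x] by (auto simp: k_def inv)
  ultimately have "f (k x - x) = 0" by (simp add: linear_functionalD[OF f(1)])
  moreover have "k y = y" if "f y = 0" for y
    using g(2) h(2) that inv(1)[of y] by (simp add: k_def fixes_pointwise_def)
  ultimately have "k (k x - x) = k x - x" by blast
  moreover obtain m where "m > 0" "k ^^ m = id" using finite_order[OF G k] by blast
  ultimately have "k x = x" using transvection_finite_order sg(3)[OF k] by blast
  then show "g x = h x" using inv by (metis comp_apply k_def)
qed

text \<open>
  By the previous lemma the stabilizer embeds into the group of \<open>d\<close>-th roots of unity, where \<open>d\<close>
  is its order.
\<close>

lemma pointwise_stabilizer_cyclic:
  fixes emb :: "'k \<Rightarrow> complex"
  assumes emb: "inj emb" "emb 1 = 1" "\<And>x y. emb (x * y) = emb x * emb y"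
    and G: "subgroup G (GL s)" "finite G" and f: "Vector_Spaces.linear s (*) f" "f x0 \<noteq> 0"
    and g: "g \<in> G" "fixes_pointwise {x. f x = 0} g" "\<And>x. f (g x) = c * f x"
    and c: "emb c = exp (2 * of_real pi * \<i> / of_nat (card {g \<in> G. fixes_pointwise {x. f x = 0} g}))"
    and t: "t \<in> G" "fixes_pointwise {x. f x = 0} t"
  shows "\<exists>j. t = g ^^ j"
proof -
  note sg = subgroup_GL[OF G(1)]
  define C where "C = {g \<in> G. fixes_pointwise {x. f x = 0} g}"
  define d where "d = card C"
  \<comment> \<open>The character by which the stabilizer \<open>C\<close> acts on V / ker f,
    evaluated at \<open>x0\<close>.\<close>
  define \<chi> where "\<chi> h = f (h x0) / f x0" for h
  have C: "h \<in> C \<Longrightarrow> h \<in> G" "h \<in> C \<Longrightarrow> fixes_pointwise {x. f x = 0} h" for h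
    by (simp_all add: C_def)
  have \<chi>: "f (h x) = \<chi> h * f x" if hC: "h \<in> C" for h x
  proof -
    obtain e where "\<And>x. f (h x) = e * f x"
      using ex_normal_scalar[OF f sg(3)[OF C(1)[OF hC]] C(2)[OF hC]] by blast
    then show ?thesis using f(2) by (simp add: \<chi>_def)
  qed
  have finC: "finite C" using G(2) by (simp add: C_def)
  have idC: "id \<in> C" using sg(1) by (simp add: C_def fixes_pointwise_def)
  have d: "d > 0" using finC idC card_gt_0_iff unfolding d_def by blast
  have compC: "h \<circ> h' \<in> C" if "h \<in> C" "h' \<in> C" for h h'
    using that sg(2)[of h h'] by (simp add: C_def fixes_pointwise_def)
  have \<chi>_comp: "\<chi> (h \<circ> h') = \<chi> h * \<chi> h'" if "h \<in> C" "h' \<in> C" for h h'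
  proof -
    have "f (h (h' x0)) = \<chi> h * (\<chi> h' * f x0)"
      using \<chi>[OF that(1)] \<chi>[OF that(2)] by simp
    then show ?thesis using f(2) by (simp add: \<chi>_def[of "h \<circ> h'"])
  qed
  have \<chi>_nz: "\<chi> h \<noteq> 0" if h: "h \<in> C" for h
  proof
    assume "\<chi> h = 0"
    then have "f (h x) = 0" for x using \<chi>[OF h] by simp
    moreover obtain x where "h x = x0"
      using sg(4)[OF C(1)[OF h]] by (metis bij_pointE)
    ultimately show False using f(2) by metis
  qed
  have tC: "t \<in> C" using t by (simp add: C_def)
  have gC: "g \<in> C" using g by (simp add: C_def)
  have "inj_on ((\<circ>) t) C"
    using fun.inj_map[of t] sg(4)[OF t(1)] by (auto simp: bij_is_inj intro: inj_on_subset)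
  moreover from this have "(\<circ>) t ` C = C"
    using compC[OF tC] by (intro endo_inj_surj finC) auto
  ultimately have bij: "bij_betw ((\<circ>) t) C C" by (simp add: bij_betw_def)
  \<comment> \<open>Translation by \<open>t\<close> permutes \<open>C\<close>; comparing the
    products of all character values gives \<open>\<chi> t ^ d = 1\<close>.\<close>
  have "prod \<chi> C = (\<Prod>h\<in>C. \<chi> (t \<circ> h))"
    using prod.reindex_bij_betw[OF bij, of \<chi>] by simp
  also have "\<dots> = (\<Prod>h\<in>C. \<chi> t * \<chi> h)"
    by (intro prod.cong refl \<chi>_comp tC)
  also have "\<dots> = \<chi> t ^ d * prod \<chi> C" by (simp add: prod.distrib d_def)
  finally have "\<chi> t ^ d = 1" using \<chi>_nz finC by simp
  moreover have emb_pow: "emb (x ^ j) = emb x ^ j" for x j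
    by (induction j) (simp_all add: emb)
  ultimately have "emb (\<chi> t) ^ d = 1" using emb(2) by (metis emb_pow)
  \<comment> \<open>The eigenvalue \<open>c\<close> of \<open>g\<close> is the standard primitive
    \<open>d\<close>-th root of unity, so all \<open>d\<close>-th roots of unity are powers of
    it.\<close>
  then obtain j where "emb (\<chi> t) = cis (2 * pi * real j / real d)"
    using bij_betw_imp_surj_on[OF bij_betw_roots_unity[OF d]] by blast
  also have "\<dots> = cis (2 * pi / real d) ^ j"
    by (simp add: Complex.DeMoivre mult_ac)
  also have "cis (2 * pi / real d) = emb c"
    by (simp add: c C_def[symmetric] d_def cis_conv_exp mult_ac)
  also have "emb c ^ j = emb (c ^ j)" by (simp add: emb_pow)
  finally have \<chi>t: "\<chi> t = c ^ j" using emb(1) by (simp add: inj_eq)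
  have gj: "g ^^ j \<in> C \<and> (\<forall>x. f ((g ^^ j) x) = c ^ j * f x)"
  proof (induction j)
    case 0
    then show ?case using idC by (simp add: id_def)
  next
    case (Suc j)
    then show ?case using compC[OF gC, of "g ^^ j"] g(3) by (auto simp: comp_def mult.assoc)
  qed
  have "t = g ^^ j"
    by (rule pointwise_stabilizer_inj[OF G f t, of "c ^ j"]) (use \<chi>[OF tC] \<chi>t gj C in auto)
  then show ?thesis ..
qed

end

subsection \<open>Determinants\<close>

text \<open>\<open>finite_dimensional_vector_space\<close> has a basis as a parameter, while here
  only the existence of a finite spanning set is given; that locale is therefore opened inside
  single proofs, with a basis chosen there.\<close>

locale fin_dim_char_0_space = char_0_space s
  for s :: "'k::field_char_0 \<Rightarrow> 'v::ab_group_add \<Rightarrow> 'v" +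
  assumes ex_finite_spanning: "\<exists>B. finite B \<and> span B = UNIV"
begin

lemma ex_finite_basis: "\<exists>B. finite_dimensional_vector_space s B"
proof -
  obtain S where S: "finite S" "span S = UNIV" using ex_finite_spanning by blast
  obtain B where B: "B \<subseteq> S" "independent B" "S \<subseteq> span B"
    using maximal_independent_subset[of S] by blast
  have "span B = UNIV" using S(2) B(3) span_minimal[OF B(3)] subspace_span by auto
  then have "finite_dimensional_vector_space s B"
    using finite_subset[OF B(1) S(1)] B(2) by unfold_locales
  then show ?thesis ..
qed

abbreviation n where "n \<equiv> dim UNIV"

lemma finite_independent: "independent B \<Longrightarrow> finite B"
proof -
  obtain B0 where "finite_dimensional_vector_space s B0" using ex_finite_basis ..
  then interpret finite_dimensional_vector_space s B0 .
  show "independent B \<Longrightarrow> finite B" by (rule finiteI_independent)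
qed

text \<open>The functional is the coordinate along \<open>x0\<close> in a basis of \<open>H\<close>
  completed by a vector \<open>x0\<close> outside \<open>H\<close>.\<close>

lemma hyperplane_if_dim:
  assumes H: "subspace H" "dim H + 1 = n"
  shows "hyperplane H"
proof -
  obtain B where B: "B \<subseteq> H" "independent B" "H \<subseteq> span B" "card B = dim H"
    using basis_exists[of H] by blast
  have spB: "span B = H" using B span_minimal[OF B(1) H(1)] by blast
  have "H \<noteq> UNIV" using H(2) by auto
  then obtain x0 where x0: "x0 \<notin> H" by blast
  let ?B = "insert x0 B"
  have ind: "independent ?B" using independent_insertI[of x0 B] x0 spB B by simp
  have card: "card ?B = n"
    using finite_independent[OF B(2)] B(1,4) x0 H(2) by (subst card_insert_disjoint) auto
  obtain B0 where "finite_dimensional_vector_space s B0" using ex_finite_basis ..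
  then interpret finite_dimensional_vector_space s B0 .
  have sp: "span ?B = UNIV"
    using card_eq_dim[of ?B UNIV] ind card finite_independent[OF ind] by auto
  define f where "f x = representation ?B x x0" for x
  have lin: "Vector_Spaces.linear s (*) f"
    unfolding f_def linear_functional_iff
    using representation_add[OF ind] representation_scale[OF ind] sp vector_space_axioms by simp
  have fB: "f b = 0" if "b \<in> B" for b
    using representation_basis[OF ind, of b] that x0 B(1) by (auto simp: f_def)
  have f0: "f x0 = 1"
    using representation_basis[OF ind, of x0] by (simp add: f_def)
  have zero: "f x = 0" if "x \<in> H" for x
  proof (rule module_hom.eq_0_on_span[of s "(*)" f B])
    show "module_hom s (*) f" using lin by (simp add: module_hom_iff_linear)
  qed (use fB that spB in auto)
  have "x \<in> H" if x: "f x = 0" for x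
  proof -
    have "x \<in> span ?B" using sp by simp
    then obtain k where k: "x - s k x0 \<in> span B" by (auto simp: span_breakdown_eq)
    then have "f (x - s k x0) = 0" using zero spB by blast
    then have "k = 0" using x f0 by (simp add: linear_functionalD[OF lin])
    then show ?thesis using k spB by simp
  qed
  with zero have "H = {x. f x = 0}" by blast
  then show ?thesis unfolding hyperplane_def using lin f0 by (metis zero_neq_one)
qed

text \<open>The form is the determinant of the coordinates with respect to
  \<open>bs\<close>.\<close>

lemma ex_dual_alternating_form:
  assumes bs: "distinct bs" "independent (set bs)" "span (set bs) = UNIV"
  shows "\<exists>\<omega>. alternating_form s (length bs) \<omega> \<and> \<omega> bs = 1"
proof -
  define f where "f j x = representation (set bs) x (bs ! j)" for j x
  have lin: "Vector_Spaces.linear s (*) (f j)" for j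
    unfolding f_def linear_functional_iff
    using representation_add[OF bs(2)] representation_scale[OF bs(2)] bs(3) vector_space_axioms by simp
  have f: "f j (bs ! i) = (if i = j then 1 else 0)" if "i < length bs" "j < length bs" for i j
    unfolding f_def using representation_basis[OF bs(2), of "bs ! i"] that bs(1)
    by (simp add: nth_eq_iff_index_eq)
  have "detform (length bs) f bs = 1"
    using f by (subst detform_diagonal) auto
  moreover have "alternating_form s (length bs) (detform (length bs) f)"
    by (rule alternating_form_detform[OF vector_space_axioms lin])
  ultimately show ?thesis by blast
qed

text \<open>The scalar \<open>\<omega>0 (map \<phi> bs)\<close> is the determinant of
  \<open>\<phi>\<close>. Pulling a form back along \<open>\<phi>\<close> gives a form again, and
  both forms are multiples of \<open>\<omega>0\<close>.\<close>

lemma wedge_map: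
  assumes \<phi>: "Vector_Spaces.linear s s \<phi>"
    and bs: "length bs = n" "span (set bs) = UNIV"
    and \<omega>0: "alternating_form s n \<omega>0" "\<omega>0 bs = 1" and xs: "length xs = n"
  shows "wedge s (map \<phi> xs) = scale_fun (\<omega>0 (map \<phi> bs)) (wedge s xs)"
proof
  fix \<omega>
  show "wedge s (map \<phi> xs) \<omega> = scale_fun (\<omega>0 (map \<phi> bs)) (wedge s xs) \<omega>"
  proof (cases "alternating_form s n \<omega>")
    case True
    have "alternating_form s n (\<lambda>xs. \<omega> (map \<phi> xs))"
      unfolding alternating_form_def
    proof (intro allI impI conjI)
      fix ys :: "'v list" and i assume "length ys = n" "i < n"
      then show "Vector_Spaces.linear s (*) (\<lambda>x. \<omega> (map \<phi> (ys[i := x])))"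
        using alternating_form_linear[OF True, of "map \<phi> ys" i] linear_mapD[OF \<phi>]
        by (simp add: linear_functional_iff map_update)
    next
      fix ys :: "'v list" and i j assume "length ys = n" "i < n" "j < n" "i \<noteq> j \<and> ys ! i = ys ! j"
      then show "\<omega> (map \<phi> ys) = 0"
        using alternating_form_eq[OF True, of "map \<phi> ys" i j] by simp
    qed
    then have "\<omega> (map \<phi> xs) = \<omega>0 xs * \<omega> (map \<phi> bs)"
      by (rule alternating_form_unique[OF vector_space_axioms bs(2,1) \<omega>0(1) _ \<omega>0(2) xs])
    also have "\<omega> (map \<phi> bs) = \<omega>0 (map \<phi> bs) * \<omega> bs"
      by (rule alternating_form_unique[OF vector_space_axioms bs(2,1) \<omega>0(1) True \<omega>0(2)]) (simp add: bs(1))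
    also have "\<omega>0 xs * (\<omega>0 (map \<phi> bs) * \<omega> bs) = \<omega>0 (map \<phi> bs) * \<omega> xs"
      using alternating_form_unique[OF vector_space_axioms bs(2,1) \<omega>0(1) True \<omega>0(2) xs] by simp
    finally show ?thesis using True xs by (simp add: wedge_def scale_fun_def)
  next
    case False
    then show ?thesis using xs by (simp add: wedge_def scale_fun_def)
  qed
qed

lemma basis_list:
  assumes "independent B" "span B = UNIV"
  shows "\<exists>bs. set bs = B \<and> distinct bs \<and> length bs = n"
proof -
  obtain bs where "set bs = B" "distinct bs"
    using finite_distinct_list[OF finite_independent[OF assms(1)]] by blast
  moreover have "card B = n"
    using dim_span_eq_card_independent[OF assms(1)] assms(2) by simp
  ultimately show ?thesis by (metis distinct_card)
qed

text \<open>\<open>D\<close> is the determinant of \<open>\<phi>\<close>, kept as an opaque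
  scalar.\<close>

lemma ex_wedge_scalar:
  assumes \<phi>: "Vector_Spaces.linear s s \<phi>"
  shows "\<exists>D. \<forall>xs. length xs = n \<longrightarrow> wedge s (map \<phi> xs) = scale_fun D (wedge s xs)"
proof -
  obtain B where "finite_dimensional_vector_space s B" using ex_finite_basis ..
  then interpret finite_dimensional_vector_space s B .
  obtain bs where bs: "set bs = B" "distinct bs" "length bs = n"
    using basis_list[OF independent_Basis span_Basis] by blast
  obtain \<omega> where "alternating_form s n \<omega>" "\<omega> bs = 1"
    using ex_dual_alternating_form[of bs] bs independent_Basis span_Basis by auto
  then have "wedge s (map \<phi> xs) = scale_fun (\<omega> (map \<phi> bs)) (wedge s xs)" if "length xs = n" for xs
    using wedge_map[OF \<phi> bs(3) _ _ _ that] bs(1) span_Basis by simp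
  then show ?thesis by blast
qed

text \<open>In a basis of the hyperplane completed by \<open>x0\<close> the matrix of
  \<open>g\<close> is triangular, with diagonal entries \<open>c\<close>, 1, ..., 1.\<close>

lemma endo_det_fixing_hyperplane:
  assumes f: "Vector_Spaces.linear s (*) f" "f x0 \<noteq> 0"
    and g: "Vector_Spaces.linear s s g" "fixes_pointwise {x. f x = 0} g" "\<And>x. f (g x) = c * f x"
  shows "endo_det s g = c"
proof -
  define H where "H = {x. f x = 0}"
  have sub: "subspace H" by (simp add: H_def subspace_def linear_functionalD[OF f(1)])
  obtain B where B: "B \<subseteq> H" "independent B" "H \<subseteq> span B" "card B = dim H"
    using basis_exists[of H] by blast
  have spB: "span B = H" using B span_minimal[OF B(1) sub] by blast
  then have x0: "x0 \<notin> span B" using f(2) by (simp add: H_def)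
  have ind: "independent (insert x0 B)" using independent_insertI[OF x0 B(2)] .
  have sp: "span (insert x0 B) = UNIV"
  proof -
    have "x - s (f x / f x0) x0 \<in> span B" for x
      unfolding spB H_def using f(2) by (simp add: linear_functionalD[OF f(1)])
    then have "x \<in> span (insert x0 B)" for x unfolding span_breakdown_eq by blast
    then show ?thesis by blast
  qed
  obtain hs where hs: "set hs = B" "distinct hs"
    using finite_distinct_list[OF finite_independent[OF B(2)]] by blast
  let ?bs = "x0 # hs"
  have "x0 \<notin> B" using x0 span_base by blast
  then have bs: "distinct ?bs" "set ?bs = insert x0 B" using hs by auto
  have n: "length ?bs = n"
    using dim_span_eq_card_independent[OF ind] sp bs distinct_card[OF bs(1)] by simp
  obtain \<omega> where \<omega>: "alternating_form s n \<omega>" "\<omega> ?bs = 1"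
    using ex_dual_alternating_form[of ?bs] bs ind sp n by auto
  have "map g hs = hs"
    using hs(1) B(1) g(2) by (intro map_idI) (auto simp: H_def fixes_pointwise_def)
  then have map: "map g ?bs = g x0 # hs" by simp
  have lin: "Vector_Spaces.linear s (*) (\<lambda>x. \<omega> (x # hs))"
    using alternating_form_linear[OF \<omega>(1) n, of 0] n by simp
  have "\<omega> (b # hs) = 0" if b: "b \<in> B" for b
  proof -
    obtain i where "i < length hs" "hs ! i = b" using b hs(1) by (auto simp: in_set_conv_nth)
    then show ?thesis
      using alternating_form_eq[OF \<omega>(1), of "b # hs" 0 "Suc i"] n by simp
  qed
  then have "\<omega> (h # hs) = 0" if "h \<in> span B" for h
    using module_hom.eq_0_on_span[of s "(*)" "\<lambda>x. \<omega> (x # hs)" B h] lin that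
    by (simp add: module_hom_iff_linear)
  \<comment> \<open>Modulo the hyperplane, which the form no longer sees in its first slot,
    \<open>g x0\<close> is \<open>c\<close> times \<open>x0\<close>.\<close>
  moreover have "g x0 - s c x0 \<in> span B"
    unfolding spB H_def by (simp add: linear_functionalD[OF f(1)] g(3))
  ultimately have "\<omega> ((g x0 - s c x0) # hs) = 0" by blast
  then have "\<omega> (map g ?bs) = c"
    unfolding map linear_functionalD(3,4)[OF lin] \<omega>(2) by simp
  then have c: "wedge s (map g xs) = scale_fun c (wedge s xs)" if "length xs = n" for xs
    using wedge_map[OF g(1) n _ \<omega> that] bs(2) sp by simp
  show ?thesis
    unfolding endo_det_def
  proof (rule the_equality)
    show "\<forall>xs. length xs = n \<longrightarrow> wedge s (map g xs) = scale_fun c (wedge s xs)"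
      using c by blast
    fix d assume "\<forall>xs. length xs = n \<longrightarrow> wedge s (map g xs) = scale_fun d (wedge s xs)"
    then have "scale_fun d (wedge s ?bs) \<omega> = scale_fun c (wedge s ?bs) \<omega>"
      using c[OF n] n by metis
    then show "d = c" using \<omega> n by (simp add: scale_fun_def wedge_def)
  qed
qed

end

section \<open>Roots and their reflections\<close>

lemma int_submodule_image:
  fixes f :: "'m::ab_group_add \<Rightarrow> 'n::ab_group_add"
  assumes f: "\<And>x y. f (x + y) = f x + f y" "\<And>c x. f (s1 c x) = s2 c (f x)"
    and M: "int_submodule s1 M"
  shows "int_submodule s2 (f ` M)"
  unfolding int_submodule_def
proof (intro conjI ballI)
  have "f 0 = 0" using f(1)[of 0 0] by simp
  then show "0 \<in> f ` M" using M by (metis image_eqI int_submodule_def)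
  show "x + y \<in> f ` M" if xy: "x \<in> f ` M" "y \<in> f ` M" for x y
  proof -
    obtain a b where ab: "a \<in> M" "b \<in> M" "x = f a" "y = f b" using xy by blast
    then have "a + b \<in> M" using M unfolding int_submodule_def by blast
    then show ?thesis unfolding ab f(1)[symmetric] by (rule imageI)
  qed
  show "s2 c x \<in> f ` M" if cx: "c \<in> integers_of" "x \<in> f ` M" for c x
  proof -
    obtain a where a: "a \<in> M" "x = f a" using cx(2) by blast
    then have "s1 c a \<in> M" using M cx(1) unfolding int_submodule_def by blast
    then show ?thesis unfolding a f(2)[symmetric] by (rule imageI)
  qed
qed

lemma int_span_image:
  fixes f :: "'m::ab_group_add \<Rightarrow> 'n::ab_group_add"
  assumes f: "\<And>x y. f (x + y) = f x + f y" "\<And>c x. f (s1 c x) = s2 c (f x)"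
  shows "int_span s2 (f ` X) = f ` int_span s1 X"
proof (rule antisym)
  show "int_span s2 (f ` X) \<subseteq> f ` int_span s1 X"
  proof (rule int_span_minimal)
    show "f ` X \<subseteq> f ` int_span s1 X" by (intro image_mono int_span_superset)
    show "int_submodule s2 (f ` int_span s1 X)"
      by (rule int_submodule_image[of f s1 s2, OF f int_submodule_int_span])
  qed
  have "int_span s1 X \<subseteq> {x. f x \<in> int_span s2 (f ` X)}"
    using int_span_superset[of "f ` X" s2]
    by (intro int_span_minimal int_submodule_vimage[of s2 _ f s1, OF int_submodule_int_span f]) auto
  then show "f ` int_span s1 X \<subseteq> int_span s2 (f ` X)" by blast
qed

text \<open>\<open>M\<close> itself need not be generated by \<open>e\<close>; only its span over
  \<open>k\<close> is the line of \<open>e\<close>.\<close>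

lemma rank_one_module_line:
  assumes "vector_space s" "rank_one_fg_module s M"
  obtains e where "e \<in> M" "e \<noteq> 0" "\<And>x. x \<in> module.span s M \<longleftrightarrow> (\<exists>k. x = s k e)"
proof -
  interpret vector_space s by fact
  obtain B where B: "B \<subseteq> M" "independent B" "M \<subseteq> span B" "card B = dim M"
    using basis_exists[of M] by blast
  have "card B = 1" using assms(2) B(4) by (simp add: rank_one_fg_module_def)
  then obtain e where e: "B = {e}" by (metis card_1_singletonE)
  have "e \<noteq> 0" using B(2) e by simp
  moreover have "span M = span B" using span_mono[OF B(1)] span_minimal[OF B(3) subspace_span] by blast
  then have "x \<in> span M \<longleftrightarrow> (\<exists>k. x = s k e)" for x
    using e by (auto simp: span_singleton)
  ultimately show ?thesis using that[of e] B(1) e by blast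
qed

context hermitian_pairing
begin

sublocale V: fin_dim_char_0_space sV
  using finite_dim_V by unfold_locales

section \<open>The embedding, complex conjugation on k, and the pairing\<close>

lemma emb_0: "emb 0 = 0"
  using emb_add[of 0 0] by simp

lemma emb_diff: "emb (x - y) = emb x - emb y"
  using emb_add[of "x - y" y] by (simp add: algebra_simps)

lemma inj_emb: "inj emb"
proof (rule injI, rule ccontr)
  fix x y assume "emb x = emb y" "x \<noteq> y"
  then have "emb ((x - y) * inverse (x - y)) = 0" by (simp only: emb_mult emb_diff) simp
  moreover have "(x - y) * inverse (x - y) = 1" using \<open>x \<noteq> y\<close> by simp
  ultimately show False using emb_one by (metis zero_neq_one)
qed

lemma emb_of_int: "emb (of_int m) = of_int m"
proof -
  have nat: "emb (of_nat m) = of_nat m" for m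
    by (induction m) (simp_all add: emb_0 emb_add emb_one)
  have "emb (- x) = - emb x" for x using emb_diff[of 0 x] emb_0 by simp
  then show ?thesis by (cases m rule: int_diff_cases) (simp add: emb_diff nat)
qed

text \<open>\<open>emb\<close> commutes with integer polynomials and is injective. Through this,
  conjugation in the complex numbers is seen to preserve the integers of \<open>k\<close>.\<close>

lemma algebraic_int_emb: "algebraic_int (emb x) \<longleftrightarrow> algebraic_int x"
proof -
  have "emb (poly (map_poly of_int p) x) = poly (map_poly of_int p) (emb x)" for p :: "int poly"
    by (induction p) (simp_all add: map_poly_pCons emb_0 emb_add emb_mult emb_of_int)
  moreover have "emb y = 0 \<longleftrightarrow> y = 0" for y using inj_emb emb_0 by (metis injD)
  ultimately show ?thesis unfolding algebraic_int_altdef_ipoly by metis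
qed

text \<open>Complex conjugation pulled back to \<open>k\<close>, so that semi-linearity of the
  pairing becomes an identity inside \<open>k\<close>.\<close>

definition conj_k :: "'k \<Rightarrow> 'k" where
  "conj_k c = (SOME d. emb d = cnj (emb c))"

lemma emb_conj_k: "emb (conj_k c) = cnj (emb c)"
proof -
  have "\<exists>d. emb d = cnj (emb c)" using conj_stable[of c] by (metis rangeE)
  then show ?thesis unfolding conj_k_def by (rule someI_ex)
qed

lemma conj_k_simps:
  "conj_k (x + y) = conj_k x + conj_k y" "conj_k (x * y) = conj_k x * conj_k y"
  "conj_k (conj_k x) = x"
  by (rule injD[OF inj_emb]; simp add: emb_conj_k emb_add emb_mult)+

lemma conj_k_integers: "c \<in> integers_of \<Longrightarrow> conj_k c \<in> integers_of"
  unfolding integers_of_def by (simp flip: algebraic_int_emb add: emb_conj_k)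

lemma pair_scale_right': "pair v (sW c w) = conj_k c * pair v w"
  by (rule injD[OF inj_emb]) (simp add: pair_scale_right emb_conj_k emb_mult)

lemma pair_diff_left: "pair (v - v') w = pair v w - pair v' w"
  using pair_add_left[of "v - v'" v' w] by (simp add: algebra_simps)

lemma pair_diff_right: "pair v (w - w') = pair v w - pair v w'"
  using pair_add_right[of v "w - w'" w'] by (simp add: algebra_simps)

lemma pair_0: "pair 0 w = 0" "pair v 0 = 0"
  using pair_diff_left[of 0 0 w] pair_diff_right[of v 0 0] by simp_all

lemma linear_pair: "Vector_Spaces.linear sV (*) (\<lambda>x. pair x w)"
  by (simp add: linear_functional_iff V.vector_space_axioms pair_add_left pair_scale_left)

lemma pair_right_eqI: "(\<And>v. pair v w = pair v w') \<Longrightarrow> w = w'"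
  using nondegenerate_right[of "w - w'"] by (simp add: pair_diff_right)

text \<open>The dual module of \<open>J\<close> inside V; the weight lattice is the intersection of
  the polars of all coroot modules.\<close>

definition polar :: "'w set \<Rightarrow> 'v set" where
  "polar J = {x. \<forall>y\<in>J. pair x y \<in> integers_of}"

abbreviation refl :: "('k, 'v, 'w) root \<Rightarrow> 'v \<Rightarrow> 'v" where
  "refl \<equiv> root_reflection sV sW pair"

lemma pairing_ideal_superset: "\<alpha> \<in> I \<Longrightarrow> \<beta> \<in> J \<Longrightarrow> pair \<alpha> \<beta> \<in> pairing_ideal pair I J"
  unfolding pairing_ideal_def by (rule subsetD[OF int_span_superset]) blast

text \<open>The vectors used in the definition of the reflection. They lie in the lines spanned by
  the two modules, but need not lie in the modules.\<close>

definition normal_pair :: "('k, 'v, 'w) root \<Rightarrow> 'v \<Rightarrow> 'w \<Rightarrow> bool" where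
  "normal_pair r v w \<longleftrightarrow> v \<in> module.span sV (root_mod r) \<and> w \<in> module.span sW (coroot_mod r) \<and>
     pair v w = 1 - root_scalar r"

lemma root_scalar_neq_1: "is_root sV sW pair r \<Longrightarrow> 1 - root_scalar r \<noteq> 0"
  by (simp add: is_root_def)

text \<open>If the two lines were orthogonal the pairing ideal would be 0, but it contains
  \<open>1 - root_scalar r\<close>. A generator of the first line is then rescaled.\<close>

lemma ex_normal_pair:
  assumes r: "is_root sV sW pair r"
  shows "\<exists>v w. normal_pair r v w"
proof -
  note \<zeta> = root_scalar_neq_1[OF r]
  have IJ: "rank_one_fg_module sV (root_mod r)" "rank_one_fg_module sW (coroot_mod r)"
    using r by (simp_all add: is_root_def)
  obtain e where "e \<in> root_mod r" "e \<noteq> 0" and e: "\<And>x. x \<in> V.span (root_mod r) \<longleftrightarrow> (\<exists>k. x = sV k e)"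
    by (rule rank_one_module_line[OF V.vector_space_axioms IJ(1)]) (rule that)
  obtain f where "f \<in> coroot_mod r" "f \<noteq> 0" and f: "\<And>x. x \<in> W.span (coroot_mod r) \<longleftrightarrow> (\<exists>k. x = sW k f)"
    by (rule rank_one_module_line[OF W.vector_space_axioms IJ(2)]) (rule that)
  have "pair e f \<noteq> 0"
  proof
    assume ef: "pair e f = 0"
    have "pair \<alpha> \<beta> = 0" if \<alpha>: "\<alpha> \<in> root_mod r" and \<beta>: "\<beta> \<in> coroot_mod r" for \<alpha> \<beta>
    proof -
      obtain a b where "\<alpha> = sV a e" "\<beta> = sW b f"
        using V.span_base[OF \<alpha>] W.span_base[OF \<beta>] unfolding e f by blast
      then show ?thesis by (simp add: pair_scale_left pair_scale_right' ef)
    qed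
    then have "pairing_ideal pair (root_mod r) (coroot_mod r) \<subseteq> {0}"
      unfolding pairing_ideal_def by (intro int_span_minimal) (auto simp: int_submodule_def)
    then have "{(1 - root_scalar r) * c |c. c \<in> integers_of} \<subseteq> {0}"
      using r by (simp add: is_root_def)
    then have "(1 - root_scalar r) * 1 = 0" using one_in_integers_of by blast
    then show False using \<zeta> by simp
  qed
  then have "pair (sV ((1 - root_scalar r) / pair e f) e) f = 1 - root_scalar r"
    by (simp add: pair_scale_left)
  moreover have "f \<in> W.span (coroot_mod r)" using f W.scale_one by metis
  ultimately show ?thesis using e unfolding normal_pair_def by blast
qed

context
  fixes r v w
  assumes r: "is_root sV sW pair r" and vw: "normal_pair r v w"
begin

lemma pair_normal_pair: "pair v w = 1 - root_scalar r"
  using vw by (simp add: normal_pair_def)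

lemma normal_pair_nz: "v \<noteq> 0" "pair v w \<noteq> 0"
  using pair_normal_pair root_scalar_neq_1[OF r] pair_0 by auto

lemma span_root_mod: "x \<in> module.span sV (root_mod r) \<longleftrightarrow> (\<exists>a. x = sV a v)"
proof -
  have "rank_one_fg_module sV (root_mod r)" using r by (simp add: is_root_def)
  then obtain e where "e \<in> root_mod r" "e \<noteq> 0" and e: "\<And>x. x \<in> V.span (root_mod r) \<longleftrightarrow> (\<exists>k. x = sV k e)"
    by (rule rank_one_module_line[OF V.vector_space_axioms]) (rule that)
  obtain k where k: "v = sV k e" using vw e by (auto simp: normal_pair_def)
  have "k \<noteq> 0" using k normal_pair_nz by auto
  then have "sV a e = sV (a / k) v" for a by (simp add: k)
  then show ?thesis unfolding e k by (metis V.scale_scale)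
qed

lemma span_coroot_mod: "x \<in> module.span sW (coroot_mod r) \<longleftrightarrow> (\<exists>a. x = sW a w)"
proof -
  have "rank_one_fg_module sW (coroot_mod r)" using r by (simp add: is_root_def)
  then obtain e where "e \<in> coroot_mod r" "e \<noteq> 0" and e: "\<And>x. x \<in> W.span (coroot_mod r) \<longleftrightarrow> (\<exists>k. x = sW k e)"
    by (rule rank_one_module_line[OF W.vector_space_axioms]) (rule that)
  obtain k where k: "w = sW k e" using vw e by (auto simp: normal_pair_def)
  have "k \<noteq> 0" using k normal_pair_nz pair_0 by auto
  then have "sW a e = sW (a / k) w" for a by (simp add: k)
  then show ?thesis unfolding e k by (metis W.scale_scale)
qed

lemma root_mod_multiple: "x \<in> root_mod r \<Longrightarrow> \<exists>a. x = sV a v"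
  using V.span_base span_root_mod by blast

lemma coroot_mod_multiple: "x \<in> coroot_mod r \<Longrightarrow> \<exists>a. x = sW a w"
  using W.span_base span_coroot_mod by blast

text \<open>Any other admissible pair is \<open>a v\<close>, \<open>b w\<close> with
  \<open>a * conj_k b = 1\<close>, and these factors cancel in the formula.\<close>

lemma root_reflection_eq: "refl r = (\<lambda>x. x - sV (pair x w) v)"
  unfolding root_reflection_def
proof (rule the_equality)
  show "\<exists>v'\<in>V.span (root_mod r). \<exists>w'\<in>W.span (coroot_mod r). pair v' w' = 1 - root_scalar r \<and>
      (\<lambda>x. x - sV (pair x w) v) = (\<lambda>x. x - sV (pair x w') v')"
    using vw unfolding normal_pair_def by blast
  fix g assume "\<exists>v'\<in>V.span (root_mod r). \<exists>w'\<in>W.span (coroot_mod r). pair v' w' = 1 - root_scalar r \<and>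
      g = (\<lambda>x. x - sV (pair x w') v')"
  then obtain v' w' where g: "v' \<in> V.span (root_mod r)" "w' \<in> W.span (coroot_mod r)"
      "pair v' w' = 1 - root_scalar r" "g = (\<lambda>x. x - sV (pair x w') v')"
    by blast
  obtain a b where ab: "v' = sV a v" "w' = sW b w" using g span_root_mod span_coroot_mod by blast
  then have "a * conj_k b = 1"
    using g(3) pair_normal_pair root_scalar_neq_1[OF r]
    by (simp add: pair_scale_left pair_scale_right' mult.commute)
  then have eq: "conj_k b * c * a = c" for c by (metis mult.assoc mult.commute mult.right_neutral)
  show "g = (\<lambda>x. x - sV (pair x w) v)"
    by (simp only: g(4) ab pair_scale_right' V.scale_scale eq)
qed

lemma fixed_space_root_reflection: "fixed_space (refl r) = {x. pair x w = 0}"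
  using normal_pair_nz by (auto simp: fixed_space_def root_reflection_eq)

lemma hyperplane_fixed_space_root_reflection: "V.hyperplane (fixed_space (refl r))"
  unfolding fixed_space_root_reflection V.hyperplane_def using linear_pair normal_pair_nz by blast

lemma pair_root_reflection: "pair (refl r x) w = root_scalar r * pair x w"
  by (simp add: root_reflection_eq pair_diff_left pair_scale_left pair_normal_pair algebra_simps)

text \<open>This is the root condition on the pairing ideal divided by
  \<open>1 - root_scalar r\<close>. The coefficients \<open>a\<close> and \<open>conj_k b\<close>
  run through two fractional ideals inverse to each other, a substitute for generators of the two
  modules.\<close>

lemma one_in_normalized_ideal:
  "1 \<in> int_span (*) {a * conj_k b | a b. sV a v \<in> root_mod r \<and> sW b w \<in> coroot_mod r}"
proof -
  note \<zeta> = root_scalar_neq_1[OF r]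
  let ?X = "{a * conj_k b | a b. sV a v \<in> root_mod r \<and> sW b w \<in> coroot_mod r}"
  have "pair \<alpha> \<beta> / (1 - root_scalar r) \<in> int_span (*) ?X"
    if \<alpha>: "\<alpha> \<in> root_mod r" and \<beta>: "\<beta> \<in> coroot_mod r" for \<alpha> \<beta>
  proof -
    obtain a b where ab: "\<alpha> = sV a v" "\<beta> = sW b w"
      using root_mod_multiple[OF \<alpha>] coroot_mod_multiple[OF \<beta>] by blast
    then have "pair \<alpha> \<beta> / (1 - root_scalar r) = a * conj_k b"
      using \<zeta> pair_normal_pair by (simp add: pair_scale_left pair_scale_right')
    moreover have "a * conj_k b \<in> ?X" using \<alpha> \<beta> ab by blast
    ultimately show ?thesis using int_span_superset[of ?X "(*)"] by auto
  qed
  then have "pairing_ideal pair (root_mod r) (coroot_mod r) \<subseteq> {x. x / (1 - root_scalar r) \<in> int_span (*) ?X}"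
    unfolding pairing_ideal_def
    by (intro int_span_minimal int_submodule_vimage[OF int_submodule_int_span])
      (auto simp: add_divide_distrib)
  moreover have "(1 - root_scalar r) * 1 \<in> pairing_ideal pair (root_mod r) (coroot_mod r)"
    using r one_in_integers_of unfolding is_root_def by blast
  ultimately have "(1 - root_scalar r) * 1 / (1 - root_scalar r) \<in> int_span (*) ?X" by blast
  then show ?thesis using \<zeta> by simp
qed

end

text \<open>
  The library does not know that algebraic integers form a ring; here this is read off from a root,
  whose pairing ideal is both a module and a multiple of the ring of integers.
\<close>

lemma int_submodule_integers_of:
  assumes r: "is_root sV sW pair r"
  shows "int_submodule (*) (integers_of :: 'k set)"
proof -
  let ?T = "pairing_ideal pair (root_mod r) (coroot_mod r)"
  have \<zeta>: "1 - root_scalar r \<noteq> 0" using r by (simp add: is_root_def)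
  have T: "?T = {(1 - root_scalar r) * c |c. c \<in> integers_of}" using r by (simp add: is_root_def)
  have "int_submodule (*) {c. (1 - root_scalar r) * c \<in> ?T}"
    unfolding pairing_ideal_def
    by (rule int_submodule_vimage[OF int_submodule_int_span]) (simp_all add: algebra_simps)
  moreover have "{c. (1 - root_scalar r) * c \<in> ?T} = integers_of"
    unfolding T using \<zeta> by auto
  ultimately show ?thesis by simp
qed

lemma int_submodule_polar:
  assumes Z: "int_submodule (*) (integers_of :: 'k set)"
  shows "int_submodule sV (polar J)"
  using Z unfolding int_submodule_def polar_def by (auto simp: pair_0 pair_add_left pair_scale_left)

lemma int_submodule_polar_right:
  assumes Z: "int_submodule (*) (integers_of :: 'k set)"
  shows "int_submodule sW {y. pair x y \<in> integers_of}"
  using Z unfolding int_submodule_def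
  by (auto simp: pair_0 pair_add_right pair_scale_right' conj_k_integers)

text \<open>With x - s x = <x, w> v: pairing this vector with \<beta> in J gives (1 - \<zeta>) <x,
  \<beta>>, which settles one direction after division by 1 - \<zeta>. For the other, a conj(b) <x,
  w> v = <x, b w> (a v) lies in I for all coefficients a, b, and 1 is a combination of the products
  a conj(b).\<close>

lemma mem_root_mod_iff_polar:
  assumes r: "is_root sV sW pair r"
  shows "x - refl r x \<in> root_mod r \<longleftrightarrow> x \<in> polar (coroot_mod r)"
proof -
  obtain v w where vw: "normal_pair r v w" using ex_normal_pair[OF r] by blast
  have diff: "x - refl r x = sV (pair x w) v" by (simp add: root_reflection_eq[OF r vw])
  note \<zeta> = root_scalar_neq_1[OF r]
  have I: "int_submodule sV (root_mod r)" using r by (simp add: is_root_def rank_one_fg_module_def)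
  show ?thesis
  proof
    assume x: "x - refl r x \<in> root_mod r"
    show "x \<in> polar (coroot_mod r)"
      unfolding polar_def
    proof (intro CollectI ballI)
      fix \<beta> assume \<beta>: "\<beta> \<in> coroot_mod r"
      then obtain b where b: "\<beta> = sW b w" using coroot_mod_multiple[OF r vw] by blast
      have "pair (sV (pair x w) v) \<beta> \<in> {(1 - root_scalar r) * c |c. c \<in> integers_of}"
        using r pairing_ideal_superset[OF x \<beta>] unfolding is_root_def diff by simp
      then obtain c where "c \<in> integers_of" "pair (sV (pair x w) v) \<beta> = (1 - root_scalar r) * c"
        by blast
      then have "(1 - root_scalar r) * pair x \<beta> = (1 - root_scalar r) * c"
        by (simp add: b pair_scale_left pair_scale_right' pair_normal_pair[OF r vw] mult_ac)
      then show "pair x \<beta> \<in> integers_of" using \<zeta> \<open>c \<in> integers_of\<close> by simp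
    qed
  next
    assume x: "x \<in> polar (coroot_mod r)"
    have "sV (a * conj_k b * pair x w) v \<in> root_mod r"
      if "sV a v \<in> root_mod r" "sW b w \<in> coroot_mod r" for a b
    proof -
      have "pair x (sW b w) \<in> integers_of" using x that by (simp add: polar_def)
      then have "sV (pair x (sW b w)) (sV a v) \<in> root_mod r"
        using I that unfolding int_submodule_def by blast
      then show ?thesis by (simp add: pair_scale_right' mult_ac)
    qed
    then have "int_span (*) {a * conj_k b | a b. sV a v \<in> root_mod r \<and> sW b w \<in> coroot_mod r}
        \<subseteq> {c. sV (c * pair x w) v \<in> root_mod r}"
      by (intro int_span_minimal int_submodule_vimage[OF I])
        (auto simp: V.scale_left_distrib distrib_right mult.assoc)
    then show "x - refl r x \<in> root_mod r"
      using one_in_normalized_ideal[OF r vw] unfolding diff by auto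
  qed
qed

lemma contragredient_root_reflection:
  assumes r: "is_root sV sW pair r" and g: "refl r \<in> carrier (GL sV)"
  defines "h \<equiv> contragredient sW pair (refl r)"
  shows "h \<in> carrier (GL sW)" "pair (refl r x) (h y) = pair x y"
proof -
  let ?\<zeta> = "root_scalar r"
  obtain v w where np: "normal_pair r v w" using ex_normal_pair[OF r] by blast
  note vw = root_reflection_eq[OF r np] pair_normal_pair[OF r np]
  have "\<exists>m>0. ?\<zeta> ^ m = 1" using r by (simp only: is_root_def)
  then have \<zeta>: "?\<zeta> \<noteq> 0" by (auto simp: zero_power)
  have surj: "surj (refl r)" using g by (simp add: GL_def bij_is_surj)
  \<comment> \<open>The candidate fixes the vectors orthogonal to \<open>v\<close> and scales
    \<open>w\<close> by the conjugate of the inverse of \<open>?\<zeta>\<close>, which offsets the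
    factor \<open>?\<zeta>\<close> on \<open>v\<close>. Its inverse \<open>h''\<close> is the
    adjoint of the reflection.\<close>
  define h' where "h' y = y + sW (conj_k (pair v y * inverse ?\<zeta>)) w" for y
  define h'' where "h'' y = y - sW (conj_k (pair v y)) w" for y
  have h': "pair (refl r x) (h' y) = pair x y" for x y
  proof -
    have "pair (refl r x) (h' y) =
        pair (refl r x) y + pair v y * inverse ?\<zeta> * (?\<zeta> * pair x w)"
      by (simp only: h'_def pair_add_right pair_scale_right' conj_k_simps pair_root_reflection[OF r np])
    also have "pair (refl r x) y = pair x y - pair x w * pair v y"
      by (simp add: vw(1) pair_diff_left pair_scale_left)
    finally show ?thesis using \<zeta> by simp
  qed
  have h'': "pair x (h'' y) = pair (refl r x) y" for x y
    by (simp add: h''_def vw(1) pair_diff_left pair_diff_right pair_scale_left pair_scale_right' conj_k_simps)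
  have "h' (h'' y) = y" for y
  proof (rule pair_right_eqI)
    fix z
    obtain x where "z = refl r x" using surj by (metis surjD)
    then show "pair z (h' (h'' y)) = pair z y" by (simp add: h' h'')
  qed
  moreover have "h'' (h' y) = y" for y
    by (rule pair_right_eqI) (simp add: h' h'')
  ultimately have "bij h'" by (intro o_bij[of h'' h']) (simp_all add: fun_eq_iff)
  moreover have "h' (y + z) = h' y + h' z" for y z
    by (simp add: h'_def pair_add_right distrib_right conj_k_simps W.scale_left_distrib)
  moreover have "h' (sW c y) = sW c (h' y)" for c y
    by (simp add: h'_def pair_scale_right' conj_k_simps W.scale_right_distrib mult.assoc)
  ultimately have ex: "h' \<in> carrier (GL sW) \<and> (\<forall>x y. pair (refl r x) (h' y) = pair x y)"
    using h' by (simp add: GL_def Vector_Spaces.linear_iff W.vector_space_axioms)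
  moreover have "k = h'" if "\<forall>x y. pair (refl r x) (k y) = pair x y" for k
  proof
    fix y
    show "k y = h' y"
    proof (rule pair_right_eqI)
      fix z
      obtain x where "z = refl r x" using surj by (metis surjD)
      then show "pair z (k y) = pair z (h' y)" using that h' by simp
    qed
  qed
  ultimately have "h = h'" unfolding h_def contragredient_def by (intro the_equality) blast+
  then show "h \<in> carrier (GL sW)" "pair (refl r x) (h y) = pair x y" using ex by simp_all
qed

text \<open>Recording the coroot module only through its polar in V keeps contragredients out of the
  relation, so it composes along products in the group.\<close>

definition conjugate_root :: "('v \<Rightarrow> 'v) \<Rightarrow> ('k, 'v, 'w) root \<Rightarrow> ('k, 'v, 'w) root \<Rightarrow> bool" where
  "conjugate_root g r r' \<longleftrightarrow> root_mod r' = g ` root_mod r \<and>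
     polar (coroot_mod r') = g ` polar (coroot_mod r) \<and> refl r' \<circ> g = g \<circ> refl r"

text \<open>The reflection and its contragredient preserve the pairing, so they carry a normal pair
  of \<open>r\<close> to one of \<open>r'\<close> and polars to polars.\<close>

lemma conjugate_root_act:
  assumes \<rho>: "is_root sV sW pair \<rho>" "refl \<rho> \<in> carrier (GL sV)" and r: "is_root sV sW pair r"
    and r': "r' = act_root sW pair (refl \<rho>) r" "is_root sV sW pair r'"
  shows "conjugate_root (refl \<rho>) r r'"
proof -
  let ?g = "refl \<rho>"
  let ?h = "contragredient sW pair ?g"
  have g: "Vector_Spaces.linear sV sV ?g" "bij ?g" using \<rho>(2) by (simp_all add: GL_def)
  have h: "Vector_Spaces.linear sW sW ?h" and gh: "\<And>x y. pair (?g x) (?h y) = pair x y"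
    using contragredient_root_reflection[OF \<rho>] by (simp_all add: GL_def)
  have I': "root_mod r' = ?g ` root_mod r" and J': "coroot_mod r' = ?h ` coroot_mod r"
    and \<zeta>': "root_scalar r' = root_scalar r"
    by (simp_all add: r'(1) act_root_def)
  obtain v w where vw: "normal_pair r v w" using ex_normal_pair[OF r] by blast
  have "?g v \<in> V.span (root_mod r')"
    using vw module_hom.span_image[of sV sV ?g "root_mod r"] g(1) unfolding I'
    by (auto simp: module_hom_iff_linear normal_pair_def)
  moreover have "?h w \<in> W.span (coroot_mod r')"
    using vw module_hom.span_image[of sW sW ?h "coroot_mod r"] h unfolding J'
    by (auto simp: module_hom_iff_linear normal_pair_def)
  ultimately have "normal_pair r' (?g v) (?h w)"
    using pair_normal_pair[OF r vw] by (simp add: normal_pair_def \<zeta>' gh)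
  then have s': "refl r' = (\<lambda>x. x - sV (pair x (?h w)) (?g v))"
    by (rule root_reflection_eq[OF r'(2)])
  have "refl r' \<circ> ?g = ?g \<circ> refl r"
    by (simp add: s' root_reflection_eq[OF r vw] fun_eq_iff gh V.linear_mapD[OF g(1)])
  moreover have "polar (coroot_mod r') = ?g ` polar (coroot_mod r)"
  proof -
    have "?g x \<in> polar (coroot_mod r') \<longleftrightarrow> x \<in> polar (coroot_mod r)" for x
      by (simp add: J' polar_def gh)
    moreover have "\<exists>x. z = ?g x" for z using g(2) by (metis bij_pointE)
    ultimately show ?thesis by (auto simp: image_iff) metis
  qed
  ultimately show ?thesis using I' by (simp add: conjugate_root_def)
qed

end

section \<open>Invertible modules\<close>

text \<open>
  \<open>key\<close> says that \<open>E\<close> has a dual basis up to the relations \<open>1 \<in> int_span (X t)\<close>; this makes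
  \<open>E\<close> cancellable.
\<close>

lemma cancel_invertible_module:
  fixes E :: "('a \<Rightarrow> 'k::field_char_0) set"
  assumes Z: "int_submodule (*) (integers_of :: 'k set)"
    and T: "finite T" "\<And>t. t \<in> T \<Longrightarrow> 1 \<in> int_span (*) (X t)"
    and key: "\<And>c. (\<And>t. t \<in> T \<Longrightarrow> c t \<in> X t) \<Longrightarrow>
      \<exists>m\<in>E. \<exists>\<omega>. (\<forall>y\<in>E. y \<omega> \<in> integers_of) \<and> m \<omega> = prod c T"
    and \<aa>: "int_ideal \<aa>" and eq: "ideal_times scale_fun \<aa> E = scale_fun D ` E"
  shows "\<aa> = {D * c | c. c \<in> integers_of}"
proof
  have \<aa>Z: "int_submodule (*) \<aa>" using \<aa> by (simp add: int_ideal_def)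
  have DZ: "{D * c | c. c \<in> integers_of} = (*) D ` integers_of" by blast
  have DZ_sub: "int_submodule (*) {D * c | c. c \<in> integers_of}"
    unfolding DZ by (rule int_submodule_image[OF _ _ Z]) (simp_all add: algebra_simps)
  show "\<aa> \<subseteq> {D * c | c. c \<in> integers_of}"
  proof
    \<comment> \<open>It suffices to place each \<open>a * prod c T\<close> in the principal ideal:
      \<open>a\<close> times \<open>m\<close> lies in \<open>D\<close> times \<open>E\<close>, and
      evaluation at \<open>\<omega>\<close> is integral on \<open>E\<close>.\<close>
    fix a assume a: "a \<in> \<aa>"
    show "a \<in> {D * c | c. c \<in> integers_of}"
    proof (rule int_submodule_prod_mem[OF T(1) DZ_sub T(2)])
      fix c assume "\<And>t. t \<in> T \<Longrightarrow> c t \<in> X t"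
      then obtain m \<omega> where m: "m \<in> E" "\<forall>y\<in>E. y \<omega> \<in> integers_of" "m \<omega> = prod c T"
        using key[of c] by blast
      have "scale_fun a m \<in> {scale_fun a x |a x. a \<in> \<aa> \<and> x \<in> E}" using a m(1) by blast
      then have "scale_fun a m \<in> ideal_times scale_fun \<aa> E"
        unfolding ideal_times_def by (rule subsetD[OF int_span_superset])
      then obtain y where "y \<in> E" "scale_fun a m = scale_fun D y" unfolding eq by blast
      then have "y \<omega> \<in> integers_of" "a * prod c T = D * y \<omega>"
        using m by (simp_all add: scale_fun_def fun_eq_iff) metis
      then show "a * prod c T \<in> {D * c | c. c \<in> integers_of}" by blast
    qed
  qed
  \<comment> \<open>Conversely, evaluation at \<open>\<omega>\<close> maps the product of
    \<open>\<aa>\<close> and \<open>E\<close> into \<open>\<aa>\<close>, and \<open>D\<close> times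
    \<open>m\<close> lies in that product.\<close>
  have "D \<in> \<aa>"
  proof (rule int_submodule_prod_mem[OF T(1) \<aa>Z T(2)])
    fix c assume "\<And>t. t \<in> T \<Longrightarrow> c t \<in> X t"
    then obtain m \<omega> where m: "m \<in> E" "\<forall>y\<in>E. y \<omega> \<in> integers_of" "m \<omega> = prod c T"
      using key[of c] by blast
    have sub: "int_submodule scale_fun {y. y \<omega> \<in> \<aa>}"
      by (rule int_submodule_vimage[OF \<aa>Z]) (simp_all add: scale_fun_def)
    have "(scale_fun a x) \<omega> \<in> \<aa>" if "a \<in> \<aa>" "x \<in> E" for a x
    proof -
      have "x \<omega> * a \<in> \<aa>" using \<aa>Z m(2) that unfolding int_submodule_def by blast
      then show ?thesis by (simp add: scale_fun_def mult.commute)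
    qed
    then have "{scale_fun a x |a x. a \<in> \<aa> \<and> x \<in> E} \<subseteq> {y. y \<omega> \<in> \<aa>}" by blast
    then have "ideal_times scale_fun \<aa> E \<subseteq> {y. y \<omega> \<in> \<aa>}"
      unfolding ideal_times_def using sub by (rule int_span_minimal)
    moreover have "scale_fun D m \<in> ideal_times scale_fun \<aa> E" unfolding eq using m(1) by blast
    ultimately have "(scale_fun D m) \<omega> \<in> \<aa>" by blast
    then show "D * prod c T \<in> \<aa>" by (simp add: scale_fun_def m(3))
  qed
  then have "c * D \<in> \<aa>" if "c \<in> integers_of" for c
    using \<aa>Z that unfolding int_submodule_def by blast
  then show "{D * c | c. c \<in> integers_of} \<subseteq> \<aa>" by (auto simp: mult.commute)
qed

lemma principal_ideal_times:
  assumes E: "int_submodule scale_fun E"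
  shows "ideal_times scale_fun {D * c | c. c \<in> integers_of} E = scale_fun D ` E"
  unfolding ideal_times_def
proof
  have "int_submodule scale_fun (scale_fun D ` E)"
    by (rule int_submodule_image[OF _ _ E]) (auto simp: scale_fun_def algebra_simps fun_eq_iff)
  moreover have "scale_fun (D * c) x \<in> scale_fun D ` E" if "c \<in> integers_of" "x \<in> E" for c x
  proof -
    have "scale_fun c x \<in> E" using E that unfolding int_submodule_def by blast
    moreover have "scale_fun (D * c) x = scale_fun D (scale_fun c x)"
      by (simp add: scale_fun_def mult.assoc)
    ultimately show ?thesis by blast
  qed
  then have "{scale_fun a x |a x. a \<in> {D * c | c. c \<in> integers_of} \<and> x \<in> E} \<subseteq> scale_fun D ` E"
    by blast
  ultimately show "int_span scale_fun {scale_fun a x |a x. a \<in> {D * c | c. c \<in> integers_of} \<and> x \<in> E}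
      \<subseteq> scale_fun D ` E"
    by (intro int_span_minimal)
  have "D * 1 \<in> {D * c | c. c \<in> integers_of}" using one_in_integers_of by blast
  then have "D \<in> {D * c | c. c \<in> integers_of}" by simp
  then have "scale_fun D ` E \<subseteq> {scale_fun a x |a x. a \<in> {D * c | c. c \<in> integers_of} \<and> x \<in> E}"
    by blast
  then show "scale_fun D ` E \<subseteq>
      int_span scale_fun {scale_fun a x |a x. a \<in> {D * c | c. c \<in> integers_of} \<and> x \<in> E}"
    by (rule subset_trans[OF _ int_span_superset])
qed

section \<open>Distinguished root systems\<close>

lemma fixed_space_conj:
  assumes "bij g" "s' \<circ> g = g \<circ> s"
  shows "fixed_space s' = g ` fixed_space s"
proof -
  have "s' (g x) = g x \<longleftrightarrow> s x = x" for x
    using assms by (metis bij_is_inj comp_apply inj_eq)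
  moreover have "\<exists>x. y = g x" for y using assms(1) by (metis bij_pointE)
  ultimately show ?thesis unfolding fixed_space_def by (auto simp: image_iff) metis
qed

context hermitian_pairing
begin

lemma emb_inj_eq: "emb x = emb y \<longleftrightarrow> x = y"
  using inj_emb by (simp add: inj_eq)

text \<open>The determinant of a reflection is its eigenvalue modulo the hyperplane, so being
  distinguished prescribes that eigenvalue.\<close>

lemma distinguished_scalar:
  assumes G: "subgroup G (GL sV)" and s: "distinguished_reflection emb sV G s"
    and f: "Vector_Spaces.linear sV (*) f" "f x0 \<noteq> 0" "fixed_space s = {x. f x = 0}"
    and c: "\<And>x. f (s x) = c * f x"
  shows "emb c = exp (2 * of_real pi * \<i> / of_nat (card {g \<in> G. V.fixes_pointwise {x. f x = 0} g}))"
proof -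
  have "s \<in> G" using s by (simp add: distinguished_reflection_def)
  moreover have "V.fixes_pointwise {x. f x = 0} s"
    unfolding f(3)[symmetric] by (simp add: V.fixes_pointwise_def fixed_space_def)
  ultimately have "endo_det sV s = c"
    using V.endo_det_fixing_hyperplane[OF f(1,2) _ _ c] V.subgroup_GL(3)[OF G] by blast
  then show ?thesis
    using s unfolding distinguished_reflection_def f(3) V.fixes_pointwise_def by simp
qed

text \<open>The hyperplane determines the order of its pointwise stabilizer, this order determines
  the eigenvalue, and the eigenvalue determines the element. Hence two root systems of the same
  group share the reflection of each hyperplane.\<close>

lemma distinguished_reflection_unique:
  assumes G: "subgroup G (GL sV)" "finite G"
    and s: "distinguished_reflection emb sV G s" "V.hyperplane (fixed_space s)"
    and s': "distinguished_reflection emb sV G s'" "fixed_space s' = fixed_space s"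
  shows "s' = s"
proof -
  obtain f x0 where f: "Vector_Spaces.linear sV (*) f" "f x0 \<noteq> 0" "fixed_space s = {x. f x = 0}"
    using s(2) unfolding V.hyperplane_def by blast
  have G': "s \<in> G" "s' \<in> G" using s s' by (simp_all add: distinguished_reflection_def)
  have fixed: "V.fixes_pointwise {x. f x = 0} s" "V.fixes_pointwise {x. f x = 0} s'"
    unfolding f(3)[symmetric] using s'(2) by (auto simp: V.fixes_pointwise_def fixed_space_def)
  obtain c where c: "\<And>x. f (s x) = c * f x"
    using V.ex_normal_scalar[OF f(1,2) V.subgroup_GL(3)[OF G(1) G'(1)] fixed(1)] by blast
  obtain c' where c': "\<And>x. f (s' x) = c' * f x"
    using V.ex_normal_scalar[OF f(1,2) V.subgroup_GL(3)[OF G(1) G'(2)] fixed(2)] by blast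
  have "emb c = emb c'"
    using distinguished_scalar[OF G(1) s(1) f c] distinguished_scalar[OF G(1) s'(1) f(1,2) _ c'] s'(2) f(3)
    by simp
  then have "c' = c" by (simp add: emb_inj_eq)
  then show ?thesis
    using V.pointwise_stabilizer_inj[OF G f(1,2) G'(2) fixed(2) c' G'(1) fixed(1)] c by simp
qed

text \<open>
  For the generating reflections of a well-generated group this map carries the weight lattice onto
  the root lattice, although it does not depend on the root system.
\<close>

definition sum_id_minus :: "('v \<Rightarrow> 'v) set \<Rightarrow> 'v \<Rightarrow> 'v" where
  "sum_id_minus T x = (\<Sum>t\<in>T. x - t x)"

lemma linear_sum_id_minus:
  assumes "\<And>t. t \<in> T \<Longrightarrow> Vector_Spaces.linear sV sV t"
  shows "Vector_Spaces.linear sV sV (sum_id_minus T)"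
proof (rule V.linear_mapI)
  show "sum_id_minus T (x + y) = sum_id_minus T x + sum_id_minus T y" for x y
    unfolding sum_id_minus_def sum.distrib[symmetric]
    by (rule sum.cong) (simp_all add: V.linear_mapD(2)[OF assms])
  show "sum_id_minus T (sV c x) = sV c (sum_id_minus T x)" for c x
    unfolding sum_id_minus_def V.scale_sum_right
    by (rule sum.cong) (simp_all add: V.linear_mapD(4)[OF assms] V.scale_right_diff_distrib)
qed

context
  fixes R G
  assumes R: "distinguished_root_system emb sV sW pair R" and G_eq: "root_system_group sV sW pair R = G"
    and G: "subgroup G (GL sV)" "finite G"
begin

lemma generate_refl: "G = generate (GL sV) (refl ` R)"
  using G_eq by (simp add: root_system_group_def)

lemma root_in: "r \<in> R \<Longrightarrow> is_root sV sW pair r"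
  using R by (simp add: distinguished_root_system_def root_system_def)

lemma distinguished_refl: "r \<in> R \<Longrightarrow> distinguished_reflection emb sV G (refl r)"
  using R G_eq by (simp add: distinguished_root_system_def)

lemma refl_in: "r \<in> R \<Longrightarrow> refl r \<in> G"
  using distinguished_refl by (simp add: distinguished_reflection_def)

lemma refl_carrier: "r \<in> R \<Longrightarrow> refl r \<in> carrier (GL sV)"
  using refl_in subgroup.subset[OF G(1)] by blast

lemma hyperplane_refl: "r \<in> R \<Longrightarrow> V.hyperplane (fixed_space (refl r))"
  using hyperplane_fixed_space_root_reflection ex_normal_pair root_in by blast

lemma act_root_in: "\<rho> \<in> R \<Longrightarrow> r \<in> R \<Longrightarrow> act_root sW pair (refl \<rho>) r \<in> R"
  using R unfolding distinguished_root_system_def root_system_def by blast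

text \<open>The reflections of the roots permute \<open>R\<close> and generate
  \<open>G\<close>.\<close>

lemma ex_conjugate_root:
  assumes "g \<in> G"
  shows "\<forall>r\<in>R. \<exists>r'\<in>R. conjugate_root g r r'"
  using G generate_refl assms
proof (induction g rule: V.generate_finite_induct)
  case id
  have "conjugate_root id r r" for r by (simp add: conjugate_root_def)
  then show ?case by blast
next
  case (comp a g)
  obtain \<rho> where \<rho>: "\<rho> \<in> R" "a = refl \<rho>" using comp.hyps(1) by blast
  show ?case
  proof
    fix r assume "r \<in> R"
    then obtain r' where r': "r' \<in> R" "conjugate_root g r r'" using comp.IH by blast
    let ?r = "act_root sW pair a r'"
    have "conjugate_root a r' ?r"
      unfolding \<rho>(2) using \<rho>(1) r'(1)
      by (intro conjugate_root_act root_in refl_carrier act_root_in refl)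
    then have "conjugate_root (a \<circ> g) r ?r"
      using r'(2) unfolding conjugate_root_def by (metis comp_assoc image_comp)
    then show "\<exists>r'\<in>R. conjugate_root (a \<circ> g) r r'" using act_root_in \<rho> r'(1) by blast
  qed
qed

lemma fixed_space_conjugate_root:
  assumes "g \<in> G" "conjugate_root g r r'"
  shows "fixed_space (refl r') = g ` fixed_space (refl r)"
  using assms V.subgroup_GL(4)[OF G(1)] by (intro fixed_space_conj) (auto simp: conjugate_root_def)

text \<open>Used both for all root reflections and for a smaller generating set. Some
  \<open>g\<close> carries the hyperplane of \<open>t\<close> to that of a generator; transporting
  the root of this generator back by the inverse of \<open>g\<close> gives \<open>r\<close>.\<close>

lemma ex_root_reflecting:
  assumes A: "G = generate (GL sV) A" "A \<subseteq> refl ` R" and t: "t \<in> G" "V.hyperplane (fixed_space t)"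
  shows "\<exists>r\<in>R. \<exists>r0\<in>R. refl r0 \<in> A \<and> (\<exists>g\<in>G. conjugate_root g r0 r) \<and> fixed_space (refl r) = fixed_space t"
proof -
  obtain a g where a: "a \<in> A" and g: "g \<in> G" "fixed_space a = g ` fixed_space t"
    using V.hyperplane_conj_to_generator[OF G A(1) _ t] hyperplane_refl A(2) by blast
  obtain r0 where r0: "r0 \<in> R" "a = refl r0" using a A(2) by blast
  let ?h = "inv_into UNIV g"
  have h: "?h \<in> G" by (rule V.subgroup_GL(5)[OF G(1) g(1)])
  then obtain r where r: "r \<in> R" "conjugate_root ?h r0 r" using ex_conjugate_root r0(1) by blast
  have "fixed_space (refl r) = ?h ` g ` fixed_space t"
    using fixed_space_conjugate_root[OF h r(2)] g(2) r0(2) by simp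
  also have "\<dots> = fixed_space t"
    using V.subgroup_GL(4)[OF G(1) g(1)] by (simp add: bij_is_inj image_inv_f_f)
  finally show ?thesis using r r0 a h by blast
qed

text \<open>The reflection of a root with the given hyperplane is distinguished, so it generates the
  cyclic pointwise stabilizer of that hyperplane, to which \<open>t\<close> belongs.\<close>

lemma reflection_power_of_root_reflection:
  assumes t: "t \<in> G" "V.hyperplane (fixed_space t)"
  shows "\<exists>r\<in>R. fixed_space (refl r) = fixed_space t \<and> (\<exists>j. t = refl r ^^ j)"
proof -
  obtain r where r: "r \<in> R" "fixed_space (refl r) = fixed_space t"
    using ex_root_reflecting[OF generate_refl _ t] by blast
  obtain v w where vw: "normal_pair r v w" using ex_normal_pair[OF root_in[OF r(1)]] by blast
  note rt = root_in[OF r(1)] vw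
  note fs = fixed_space_root_reflection[OF rt]
  have "\<exists>j. t = refl r ^^ j"
  proof (rule V.pointwise_stabilizer_cyclic[of emb G "\<lambda>x. pair x w" v "refl r" "root_scalar r",
        OF inj_emb emb_one emb_mult G linear_pair normal_pair_nz(2)[OF rt]])
    show "refl r \<in> G" by (rule refl_in[OF r(1)])
    show "V.fixes_pointwise {x. pair x w = 0} (refl r)"
      unfolding fs[symmetric] by (simp add: V.fixes_pointwise_def fixed_space_def)
    show "pair (refl r x) w = root_scalar r * pair x w" for x by (rule pair_root_reflection[OF rt])
    show "emb (root_scalar r) = exp (2 * of_real pi * \<i> /
        of_nat (card {g \<in> G. V.fixes_pointwise {x. pair x w = 0} g}))"
      by (rule distinguished_scalar[of G "refl r" "\<lambda>x. pair x w" v "root_scalar r",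
            OF G(1) distinguished_refl[OF r(1)] linear_pair normal_pair_nz(2)[OF rt] fs
            pair_root_reflection[OF rt]])
    show "t \<in> G" by fact
    show "V.fixes_pointwise {x. pair x w = 0} t"
      unfolding fs[symmetric] r(2) by (simp add: V.fixes_pointwise_def fixed_space_def)
  qed
  then show ?thesis using r by blast
qed

lemma mem_weight_lattice_iff:
  assumes Z: "int_submodule (*) (integers_of :: 'k set)"
  shows "x \<in> weight_lattice sW pair R \<longleftrightarrow> (\<forall>r\<in>R. x \<in> polar (coroot_mod r))"
proof
  assume x: "x \<in> weight_lattice sW pair R"
  have "(\<Union>r\<in>R. coroot_mod r) \<subseteq> coroot_lattice sW R"
    unfolding coroot_lattice_def by (rule int_span_superset)
  then show "\<forall>r\<in>R. x \<in> polar (coroot_mod r)"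
    using x unfolding weight_lattice_def polar_def by blast
next
  assume "\<forall>r\<in>R. x \<in> polar (coroot_mod r)"
  then have "(\<Union>r\<in>R. coroot_mod r) \<subseteq> {y. pair x y \<in> integers_of}"
    unfolding polar_def by blast
  then have "coroot_lattice sW R \<subseteq> {y. pair x y \<in> integers_of}"
    unfolding coroot_lattice_def using int_submodule_polar_right[OF Z] by (rule int_span_minimal)
  then show "x \<in> weight_lattice sW pair R" unfolding weight_lattice_def by blast
qed

lemma root_mod_polar:
  assumes "r \<in> R" "r' \<in> R" "x \<in> root_mod r"
  shows "x \<in> polar (coroot_mod r')"
proof -
  have "pairing_ideal pair (root_mod r) (coroot_mod r') \<subseteq> integers_of"
    using R assms(1,2) unfolding distinguished_root_system_def root_system_def by blast
  then show ?thesis unfolding polar_def using pairing_ideal_superset[OF assms(3)] by blast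
qed

section \<open>Coordinates and lattices from dim V generating reflections\<close>

context
  fixes T :: "('v \<Rightarrow> 'v) set" and \<rho> and v :: "('v \<Rightarrow> 'v) \<Rightarrow> 'v" and w :: "('v \<Rightarrow> 'v) \<Rightarrow> 'w"
  assumes irr: "irreducible_group sV G"
    and T: "G = generate (GL sV) T" "finite T" "card T \<le> V.n"
    and \<rho>: "\<And>t. t \<in> T \<Longrightarrow> \<rho> t \<in> R" "\<And>t. t \<in> T \<Longrightarrow> refl (\<rho> t) = t"
    and vw: "\<And>t. t \<in> T \<Longrightarrow> normal_pair (\<rho> t) (v t) (w t)"
begin

lemma generator_eq: "t \<in> T \<Longrightarrow> t x = x - sV (pair x (w t)) (v t)"
  using root_reflection_eq[OF root_in[OF \<rho>(1)] vw] \<rho>(2) by metis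

lemma generator_sub: "t \<in> T \<Longrightarrow> x - t x = sV (pair x (w t)) (v t)"
  by (simp add: generator_eq)

lemma generator_in: "t \<in> T \<Longrightarrow> t \<in> G"
  unfolding T(1) by (rule generate.incl)

lemma ex_moved: "\<exists>g\<in>G. \<exists>x. g x \<noteq> x"
proof -
  have "R \<noteq> {}"
    using R irr unfolding distinguished_root_system_def root_system_def irreducible_group_def by auto
  then obtain r where r: "r \<in> R" by blast
  then have "\<exists>x. refl r x \<noteq> x"
    using hyperplane_refl[OF r] unfolding V.hyperplane_def fixed_space_def by auto
  then show ?thesis using refl_in[OF r] by blast
qed

text \<open>A root exists because V is nonzero and is spanned by the root modules.\<close>

lemma integers_ring: "int_submodule (*) (integers_of :: 'k set)"
proof -
  have "R \<noteq> {}"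
    using R irr unfolding distinguished_root_system_def root_system_def irreducible_group_def by auto
  then show ?thesis using int_submodule_integers_of root_in by blast
qed

lemma invariant_subspace:
  assumes "module.subspace sV U" "\<And>g. g \<in> G \<Longrightarrow> g ` U \<subseteq> U"
  shows "U = {0} \<or> U = UNIV"
  using irr assms unfolding irreducible_group_def by blast

text \<open>Such an \<open>x\<close> is fixed by all generators, hence by \<open>G\<close>. The
  fixed vectors form an invariant subspace, which is 0 because \<open>G\<close> acts irreducibly and
  nontrivially.\<close>

lemma kernels_trivial:
  assumes "\<And>t. t \<in> T \<Longrightarrow> pair x (w t) = 0"
  shows "x = 0"
proof -
  let ?U = "{x. \<forall>g\<in>G. g x = x}"
  have "V.subspace ?U"
    by (auto simp: V.subspace_def V.linear_mapD[OF V.subgroup_GL(3)[OF G(1)]])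
  moreover have "g ` ?U \<subseteq> ?U" if "g \<in> G" for g
  proof -
    have "g x = x" if "x \<in> ?U" for x using that \<open>g \<in> G\<close> by blast
    then have "g ` ?U = ?U" by force
    then show ?thesis by simp
  qed
  ultimately have "?U = {0} \<or> ?U = UNIV"
    by (rule invariant_subspace)
  moreover have "?U \<noteq> UNIV" using ex_moved by blast
  moreover have "g x = x" if "g \<in> G" for g
    using G T(1) that
  proof (induction g rule: V.generate_finite_induct)
    case (comp a g)
    then show ?case using generator_eq[of a x] assms by simp
  qed simp
  ultimately show ?thesis by blast
qed

text \<open>Every \<open>g\<close> moves every vector by an element of this span, so the span is
  invariant; were it 0, \<open>G\<close> would act trivially.\<close>

lemma span_root_vectors: "module.span sV (v ` T) = UNIV"
proof -
  let ?U = "V.span (v ` T)"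
  have moves: "\<forall>x. g x - x \<in> ?U" if "g \<in> G" for g
    using G T(1) that
  proof (induction g rule: V.generate_finite_induct)
    case id
    then show ?case by (simp add: V.span_zero)
  next
    case (comp a g)
    have "a (g x) - x \<in> ?U" for x
    proof -
      have "a (g x) - x = (g x - x) - sV (pair (g x) (w a)) (v a)"
        using generator_eq[OF comp.hyps(1)] by simp
      moreover have "v a \<in> ?U" using comp.hyps(1) by (simp add: V.span_base)
      then have "(g x - x) - sV (pair (g x) (w a)) (v a) \<in> ?U"
        using comp.IH by (intro V.span_diff[of "g x - x"] V.span_scale) blast+
      ultimately show ?thesis by (simp only:)
    qed
    then show ?case by simp
  qed
  have "g ` ?U \<subseteq> ?U" if "g \<in> G" for g
  proof
    fix y assume "y \<in> g ` ?U"
    then obtain x where "x \<in> ?U" "y = g x" by blast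
    then show "y \<in> ?U" using V.span_add[of "g x - x" "v ` T" x] moves[OF that] by simp
  qed
  then have "?U = {0} \<or> ?U = UNIV" by (intro invariant_subspace V.subspace_span)
  moreover have "?U \<noteq> {0}"
  proof
    assume "?U = {0}"
    then have "g x - x = 0" if "g \<in> G" for g x using moves[OF that] by blast
    then show False using ex_moved by auto
  qed
  ultimately show ?thesis by blast
qed

text \<open>A spanning set has at least dim V elements and \<open>T\<close> has at most that many,
  so both bounds are attained.\<close>

lemma card_generators: "card T = V.n" "card (v ` T) = V.n"
proof -
  have "V.n \<le> card (v ` T)"
    using V.dim_le_card[of UNIV "v ` T"] span_root_vectors T(2) by simp
  moreover have "card (v ` T) \<le> card T" by (rule card_image_le[OF T(2)])
  ultimately show "card T = V.n" "card (v ` T) = V.n" using T(3) by simp_all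
qed

lemma inj_root_vectors: "inj_on v T"
  using eq_card_imp_inj_on[OF T(2)] card_generators by simp

lemma independent_root_vectors: "V.independent (v ` T)"
proof -
  obtain B where "finite_dimensional_vector_space sV B" using V.ex_finite_basis ..
  then interpret FV: finite_dimensional_vector_space sV B .
  show ?thesis
    using FV.card_eq_dim[of "v ` T" UNIV] card_generators(2) span_root_vectors T(2) by simp
qed

lemma coordinates_eq:
  assumes "(\<Sum>t\<in>T. sV (c t) (v t)) = (\<Sum>t\<in>T. sV (d t) (v t))" "t \<in> T"
  shows "c t = d t"
proof -
  define u where "u x = c (inv_into T v x) - d (inv_into T v x)" for x
  have "(\<Sum>x\<in>v ` T. sV (u x) x) = (\<Sum>t\<in>T. sV (u (v t)) (v t))"
    using sum.reindex[OF inj_root_vectors] by simp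
  also have "\<dots> = (\<Sum>t\<in>T. sV (c t) (v t) - sV (d t) (v t))"
    by (rule sum.cong) (simp_all add: u_def inv_into_f_f[OF inj_root_vectors] V.scale_left_diff_distrib)
  also have "\<dots> = 0" using assms(1) by (simp add: sum_subtractf)
  finally have "u (v t) = 0"
    using V.independentD[OF independent_root_vectors, of "v ` T" u "v t"] T(2) assms(2) by simp
  then show ?thesis using assms(2) by (simp add: u_def inv_into_f_f[OF inj_root_vectors])
qed

abbreviation \<phi> :: "'v \<Rightarrow> 'v" where
  "\<phi> \<equiv> sum_id_minus T"

lemma \<phi>_eq: "\<phi> x = (\<Sum>t\<in>T. sV (pair x (w t)) (v t))"
  unfolding sum_id_minus_def by (rule sum.cong) (simp_all add: generator_sub)

lemma linear_\<phi>: "Vector_Spaces.linear sV sV \<phi>"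
  by (rule linear_sum_id_minus) (rule V.subgroup_GL(3)[OF G(1) generator_in])

text \<open>The coordinates of \<open>\<phi> x\<close> in the basis \<open>v t\<close> are the
  pairings of \<open>x\<close> with \<open>w t\<close>, and these determine
  \<open>x\<close>.\<close>

lemma surj_\<phi>: "\<exists>x. \<phi> x = y"
proof -
  obtain B where "finite_dimensional_vector_space sV B" using V.ex_finite_basis ..
  then interpret FV: finite_dimensional_vector_space sV B .
  have "x = y" if "\<phi> x = \<phi> y" for x y
  proof -
    have "pair (x - y) (w t) = 0" if "t \<in> T" for t
      using coordinates_eq[OF \<open>\<phi> x = \<phi> y\<close>[unfolded \<phi>_eq] that] by (simp add: pair_diff_left)
    then have "x - y = 0" by (rule kernels_trivial)
    then show ?thesis by simp
  qed
  then have "inj \<phi>" by (auto intro: injI)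
  then have "surj \<phi>" by (rule FV.linear_inj_imp_surj[OF linear_\<phi>])
  then show ?thesis by (metis surjD)
qed

text \<open>The preimages of the \<open>v t\<close> are the basis dual to the \<open>w t\<close>,
  the analogue of fundamental weights.\<close>

lemma \<phi>_eq_multiple:
  assumes "\<phi> x = sV a (v t)" "t \<in> T" "u \<in> T"
  shows "pair x (w u) = (if u = t then a else 0)"
proof (rule coordinates_eq[OF _ assms(3)])
  have "(\<Sum>u\<in>T. sV (if u = t then a else 0) (v u)) = (\<Sum>u\<in>T. if u = t then sV a (v u) else 0)"
    by (rule sum.cong) simp_all
  also have "\<dots> = sV a (v t)" using T(2) assms(2) by simp
  finally show "(\<Sum>u\<in>T. sV (pair x (w u)) (v u)) = (\<Sum>u\<in>T. sV (if u = t then a else 0) (v u))"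
    using assms(1) by (simp add: \<phi>_eq)
qed

text \<open>Some conjugate \<open>r1\<close> of a generator's root has the hyperplane of
  \<open>r\<close>. Then both have the same distinguished reflection, and injectivity of
  \<open>refl\<close> on \<open>R\<close> gives \<open>r1 = r\<close>.\<close>

lemma conjugate_to_generator:
  assumes r: "r \<in> R"
  shows "\<exists>t\<in>T. \<exists>g\<in>G. conjugate_root g (\<rho> t) r"
proof -
  have inj: "inj_on refl R" using R by (simp add: distinguished_root_system_def)
  have "T \<subseteq> refl ` R" using \<rho> by (metis image_eqI subsetI)
  then obtain r1 r0 g where r1: "r1 \<in> R" "r0 \<in> R" "refl r0 \<in> T" "g \<in> G" "conjugate_root g r0 r1"
      "fixed_space (refl r1) = fixed_space (refl r)"
    using ex_root_reflecting[OF T(1) _ refl_in[OF r] hyperplane_refl[OF r]] by blast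
  have "refl r1 = refl r"
    using distinguished_reflection_unique[OF G distinguished_refl[OF r] hyperplane_refl[OF r]
        distinguished_refl[OF r1(1)] r1(6)] .
  then have "r1 = r" using inj r r1(1) by (simp add: inj_on_eq_iff)
  moreover have "\<rho> (refl r0) = r0" using inj r1(2) \<rho>[OF r1(3)] by (simp add: inj_on_eq_iff)
  ultimately show ?thesis using r1(3-5) by metis
qed

text \<open>The conditions for \<open>T\<close> alone already define a G-stable set: a generator
  \<open>a\<close> changes \<open>x\<close> by an element of its root module, which pairs integrally
  with all coroots. Conjugation then reaches the remaining roots.\<close>

lemma mem_weight_lattice_iff_generators:
  "x \<in> weight_lattice sW pair R \<longleftrightarrow> (\<forall>t\<in>T. x \<in> polar (coroot_mod (\<rho> t)))"
proof
  assume "x \<in> weight_lattice sW pair R"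
  then show "\<forall>t\<in>T. x \<in> polar (coroot_mod (\<rho> t))"
    using \<rho>(1) unfolding mem_weight_lattice_iff[OF integers_ring] by blast
next
  define P where "P = {x. \<forall>t\<in>T. x \<in> polar (coroot_mod (\<rho> t))}"
  have stable: "\<forall>x\<in>P. g x \<in> P" if "g \<in> G" for g
    using G T(1) that
  proof (induction g rule: V.generate_finite_induct)
    case (comp a g)
    have "a x \<in> P" if x: "x \<in> P" for x
      unfolding P_def
    proof (intro CollectI ballI)
      fix t assume t: "t \<in> T"
      have "x - a x \<in> root_mod (\<rho> a)"
        using mem_root_mod_iff_polar[OF root_in[OF \<rho>(1)[OF comp.hyps(1)]], of x] \<rho>(2)[OF comp.hyps(1)]
          x comp.hyps(1) by (simp add: P_def)
      then have "x - a x \<in> polar (coroot_mod (\<rho> t))"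
        using root_mod_polar \<rho>(1) comp.hyps(1) t by blast
      moreover have "x \<in> polar (coroot_mod (\<rho> t))" using x t by (simp add: P_def)
      ultimately have "x - (x - a x) \<in> polar (coroot_mod (\<rho> t))"
        using int_submodule_diff[OF V.vector_space_axioms int_submodule_polar[OF integers_ring]] by blast
      then show "a x \<in> polar (coroot_mod (\<rho> t))" by simp
    qed
    then show ?case using comp.IH by simp
  qed simp
  assume "\<forall>t\<in>T. x \<in> polar (coroot_mod (\<rho> t))"
  then have x: "x \<in> P" by (simp add: P_def)
  show "x \<in> weight_lattice sW pair R"
    unfolding mem_weight_lattice_iff[OF integers_ring]
  proof
    fix r assume "r \<in> R"
    then obtain t g where tg: "t \<in> T" "g \<in> G" "conjugate_root g (\<rho> t) r"
      using conjugate_to_generator by blast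
    have "inv_into UNIV g x \<in> P" using stable[OF V.subgroup_GL(5)[OF G(1) tg(2)]] x by blast
    then have "inv_into UNIV g x \<in> polar (coroot_mod (\<rho> t))" using tg(1) by (simp add: P_def)
    then have "g (inv_into UNIV g x) \<in> polar (coroot_mod r)"
      using tg(3) unfolding conjugate_root_def by blast
    then show "x \<in> polar (coroot_mod r)"
      using V.subgroup_GL(4)[OF G(1) tg(2)] by (simp add: bij_is_surj surj_f_inv_f)
  qed
qed

text \<open>The same argument on the other side: elements of \<open>?Q\<close> pair integrally with
  the coroots of \<open>T\<close>, so \<open>a\<close> moves them by elements of its own root
  module, which lies in \<open>?Q\<close>.\<close>

lemma root_lattice_generators: "root_lattice sV R = int_span sV (\<Union>t\<in>T. root_mod (\<rho> t))"
  unfolding root_lattice_def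
proof
  let ?Q = "int_span sV (\<Union>t\<in>T. root_mod (\<rho> t))"
  have I: "root_mod (\<rho> t) \<subseteq> ?Q" if "t \<in> T" for t
    using int_span_superset[of "\<Union>t\<in>T. root_mod (\<rho> t)" sV] that by blast
  have polar: "?Q \<subseteq> polar (coroot_mod (\<rho> t))" if "t \<in> T" for t
  proof (rule int_span_minimal[OF _ int_submodule_polar[OF integers_ring]], intro UN_least subsetI)
    show "x \<in> polar (coroot_mod (\<rho> t))" if "u \<in> T" "x \<in> root_mod (\<rho> u)" for u x
      using root_mod_polar[OF \<rho>(1)[OF \<open>u \<in> T\<close>] \<rho>(1)[OF \<open>t \<in> T\<close>]] that by blast
  qed
  have stable: "\<forall>x\<in>?Q. g x \<in> ?Q" if "g \<in> G" for g
    using G T(1) that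
  proof (induction g rule: V.generate_finite_induct)
    case (comp a g)
    have "a x \<in> ?Q" if x: "x \<in> ?Q" for x
    proof -
      have "x - a x \<in> root_mod (\<rho> a)"
        using mem_root_mod_iff_polar[OF root_in[OF \<rho>(1)[OF comp.hyps(1)]], of x] \<rho>(2)[OF comp.hyps(1)]
          polar[OF comp.hyps(1)] x by auto
      then have "x - a x \<in> ?Q" using I[OF comp.hyps(1)] by blast
      then have "x - (x - a x) \<in> ?Q"
        using int_submodule_diff[OF V.vector_space_axioms int_submodule_int_span x] by blast
      then show ?thesis by simp
    qed
    then show ?case using comp.IH by simp
  qed simp
  have "root_mod r \<subseteq> ?Q" if r: "r \<in> R" for r
  proof -
    obtain t g where tg: "t \<in> T" "g \<in> G" "conjugate_root g (\<rho> t) r"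
      using conjugate_to_generator[OF r] by blast
    then have eq: "root_mod r = g ` root_mod (\<rho> t)" by (simp add: conjugate_root_def)
    show ?thesis
      unfolding eq
    proof (rule image_subsetI)
      fix x assume "x \<in> root_mod (\<rho> t)"
      then have "x \<in> ?Q" by (rule subsetD[OF I[OF tg(1)]])
      then show "g x \<in> ?Q" using stable[OF tg(2)] by (rule bspec[rotated])
    qed
  qed
  then have "(\<Union>r\<in>R. root_mod r) \<subseteq> ?Q" by (rule UN_least)
  then show "int_span sV (\<Union>r\<in>R. root_mod r) \<subseteq> ?Q"
    using int_submodule_int_span by (rule int_span_minimal)
  show "?Q \<subseteq> int_span sV (\<Union>r\<in>R. root_mod r)"
  proof (rule int_span_mono, rule UN_least)
    show "root_mod (\<rho> t) \<subseteq> (\<Union>r\<in>R. root_mod r)" if "t \<in> T" for t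
      using \<rho>(1)[OF that] by (rule UN_upper)
  qed
qed

lemma root_lattice_eq: "root_lattice sV R = \<phi> ` weight_lattice sW pair R"
  unfolding root_lattice_generators
proof
  let ?P = "weight_lattice sW pair R"
  have "int_submodule sV (\<Inter>t\<in>T. polar (coroot_mod (\<rho> t)))"
    by (intro int_submodule_INT int_submodule_polar integers_ring)
  moreover have "?P = (\<Inter>t\<in>T. polar (coroot_mod (\<rho> t)))"
    by (auto simp: mem_weight_lattice_iff_generators)
  ultimately have "int_submodule sV ?P" by simp
  then have sub: "int_submodule sV (\<phi> ` ?P)"
    by (rule int_submodule_image[of \<phi> sV sV, OF V.linear_mapD(2)[OF linear_\<phi>] V.linear_mapD(4)[OF linear_\<phi>]])
  have "\<alpha> \<in> \<phi> ` ?P" if t: "t \<in> T" and \<alpha>: "\<alpha> \<in> root_mod (\<rho> t)" for t \<alpha>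
  proof -
    obtain a where a: "\<alpha> = sV a (v t)"
      using root_mod_multiple[OF root_in[OF \<rho>(1)[OF t]] vw[OF t] \<alpha>] by blast
    obtain x where x: "\<phi> x = \<alpha>" using surj_\<phi> by blast
    have "x \<in> polar (coroot_mod (\<rho> u))" if u: "u \<in> T" for u
    proof -
      \<comment> \<open>The preimage of a root vector for \<open>t\<close> is fixed by all other
        generators, so its integrality can be checked for each generator separately.\<close>
      have "x - u x = (if u = t then \<alpha> else 0)"
        using \<phi>_eq_multiple[OF x[unfolded a] t u] by (simp add: generator_sub[OF u] a)
      moreover have "0 \<in> root_mod (\<rho> u)"
        using root_in[OF \<rho>(1)[OF u]] by (simp add: is_root_def rank_one_fg_module_def int_submodule_def)
      ultimately have "x - u x \<in> root_mod (\<rho> u)" using \<alpha> by simp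
      then show ?thesis
        using mem_root_mod_iff_polar[OF root_in[OF \<rho>(1)[OF u]], of x] \<rho>(2)[OF u] by simp
    qed
    then have "x \<in> ?P" by (simp add: mem_weight_lattice_iff_generators)
    then show ?thesis using x by blast
  qed
  then have "(\<Union>t\<in>T. root_mod (\<rho> t)) \<subseteq> \<phi> ` ?P" by (intro UN_least subsetI)
  then show "int_span sV (\<Union>t\<in>T. root_mod (\<rho> t)) \<subseteq> \<phi> ` ?P"
    using sub by (rule int_span_minimal)
  show "\<phi> ` ?P \<subseteq> int_span sV (\<Union>t\<in>T. root_mod (\<rho> t))"
  proof
    fix y assume "y \<in> \<phi> ` ?P"
    then obtain x where x: "x \<in> ?P" "y = (\<Sum>t\<in>T. x - t x)" unfolding sum_id_minus_def by blast
    show "y \<in> int_span sV (\<Union>t\<in>T. root_mod (\<rho> t))"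
      unfolding x(2)
    proof (rule int_submodule_sum[OF int_submodule_int_span])
      fix t assume t: "t \<in> T"
      have "x \<in> polar (coroot_mod (\<rho> t))" using x(1) t by (simp add: mem_weight_lattice_iff_generators)
      then have "x - t x \<in> root_mod (\<rho> t)"
        using mem_root_mod_iff_polar[OF root_in[OF \<rho>(1)[OF t]], of x] \<rho>(2)[OF t] by simp
      with t show "x - t x \<in> int_span sV (\<Union>t\<in>T. root_mod (\<rho> t))"
        by (intro int_span_base UN_I)
    qed
  qed
qed

text \<open>\<open>m\<close> is the exterior product of the weights that \<open>\<phi>\<close> maps
  to \<open>a t\<close> times \<open>v t\<close>, and \<open>\<omega>\<close> is the determinant of
  the functionals pairing with \<open>b t\<close> times \<open>w t\<close>. The matrix of these
  pairings is diagonal with entries \<open>c t\<close>.\<close>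

lemma wedge_weight_lattice_dual:
  assumes c: "\<And>t. t \<in> T \<Longrightarrow>
    c t \<in> {a * conj_k b | a b. sV a (v t) \<in> root_mod (\<rho> t) \<and> sW b (w t) \<in> coroot_mod (\<rho> t)}"
  shows "\<exists>m\<in>exterior_power sV V.n (weight_lattice sW pair R). \<exists>\<omega>.
    (\<forall>y\<in>exterior_power sV V.n (weight_lattice sW pair R). y \<omega> \<in> integers_of) \<and> m \<omega> = prod c T"
proof -
  let ?P = "weight_lattice sW pair R"
  have "\<exists>a b. c t = a * conj_k b \<and> sV a (v t) \<in> root_mod (\<rho> t) \<and> sW b (w t) \<in> coroot_mod (\<rho> t)"
    if "t \<in> T" for t using c[OF that] by blast
  then obtain a b where ab: "\<And>t. t \<in> T \<Longrightarrow> c t = a t * conj_k (b t)"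
      "\<And>t. t \<in> T \<Longrightarrow> sV (a t) (v t) \<in> root_mod (\<rho> t)" "\<And>t. t \<in> T \<Longrightarrow> sW (b t) (w t) \<in> coroot_mod (\<rho> t)"
    by metis
  have "\<exists>x. x \<in> ?P \<and> \<phi> x = sV (a t) (v t)" if t: "t \<in> T" for t
  proof -
    have "sV (a t) (v t) \<in> root_lattice sV R"
      unfolding root_lattice_generators
      by (intro int_span_base UN_I[OF t] ab(2)[OF t])
    then show ?thesis unfolding root_lattice_eq by (elim imageE) auto
  qed
  then obtain x where x: "\<And>t. t \<in> T \<Longrightarrow> x t \<in> ?P" "\<And>t. t \<in> T \<Longrightarrow> \<phi> (x t) = sV (a t) (v t)"
    by metis
  obtain ts where ts: "set ts = T" "distinct ts" using finite_distinct_list[OF T(2)] by blast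
  have n: "length ts = V.n" using distinct_card[OF ts(2)] ts(1) card_generators(1) by simp
  define f where "f j y = pair y (sW (b (ts ! j)) (w (ts ! j)))" for j y
  let ?\<omega> = "detform V.n f"
  have alt: "alternating_form sV V.n ?\<omega>"
    unfolding f_def by (intro alternating_form_detform V.vector_space_axioms linear_pair)
  have tsT: "ts ! i \<in> T" if "i < V.n" for i using that n ts(1) nth_mem by metis
  have "wedge sV xs ?\<omega> \<in> integers_of" if xs: "length xs = V.n" "set xs \<subseteq> ?P" for xs
  proof -
    have "?\<omega> xs \<in> integers_of"
    proof (rule detform_integral[OF integers_ring])
      fix i j assume ij: "i < V.n" "j < V.n"
      then have "xs ! i \<in> ?P" using xs nth_mem by (metis subsetD)
      then have "xs ! i \<in> polar (coroot_mod (\<rho> (ts ! j)))"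
        using tsT[OF ij(2)] by (simp add: mem_weight_lattice_iff_generators)
      then show "f j (xs ! i) \<in> integers_of"
        unfolding f_def polar_def using ab(3)[OF tsT[OF ij(2)]] by blast
    qed
    then show ?thesis using alt xs by (simp add: wedge_def)
  qed
  then have "{wedge sV xs |xs. length xs = V.n \<and> set xs \<subseteq> ?P} \<subseteq> {y. y ?\<omega> \<in> integers_of}" by blast
  moreover have "int_submodule scale_fun {y. y ?\<omega> \<in> (integers_of :: 'k set)}"
    by (rule int_submodule_vimage[OF integers_ring]) (simp_all add: scale_fun_def)
  ultimately have int: "\<forall>y\<in>exterior_power sV V.n ?P. y ?\<omega> \<in> integers_of"
    unfolding exterior_power_def by (intro ballI) (drule subsetD[OF int_span_minimal], simp_all)
  let ?xs = "map x ts"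
  have f_xs: "f j (?xs ! i) = (if i = j then c (ts ! i) else 0)" if ij: "i < V.n" "j < V.n" for i j
  proof -
    have "pair (x (ts ! i)) (w (ts ! j)) = (if ts ! j = ts ! i then a (ts ! i) else 0)"
      by (rule \<phi>_eq_multiple[OF x(2)[OF tsT[OF ij(1)]] tsT[OF ij(1)] tsT[OF ij(2)]])
    then show ?thesis
      using ij n ts(2) ab(1)[OF tsT[OF ij(1)]]
      by (auto simp: f_def pair_scale_right' nth_eq_iff_index_eq mult.commute)
  qed
  then have "?\<omega> ?xs = (\<Prod>i<V.n. f i (?xs ! i))" by (intro detform_diagonal) simp
  also have "\<dots> = (\<Prod>i<V.n. c (ts ! i))" using f_xs by (intro prod.cong) auto
  also have "\<dots> = prod c T"
    using prod.reindex_bij_betw[OF bij_betw_nth[OF ts(2)], of "{..<V.n}" T c] n ts(1) by simp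
  finally have "wedge sV ?xs ?\<omega> = prod c T" using alt n by (simp add: wedge_def)
  moreover have "wedge sV ?xs \<in> exterior_power sV V.n ?P"
    unfolding exterior_power_def
  proof (rule int_span_base)
    have "length ?xs = V.n" "set ?xs \<subseteq> ?P" using n ts(1) x(1) by auto
    then show "wedge sV ?xs \<in> {wedge sV xs |xs. length xs = V.n \<and> set xs \<subseteq> ?P}" by blast
  qed
  ultimately show ?thesis using int by blast
qed

text \<open>Since \<open>\<phi>\<close> maps the weight lattice onto the root lattice, the top
  exterior powers differ by the scalar \<open>D\<close>. The principal ideal of \<open>D\<close>
  therefore satisfies the equation, and cancelling the invertible module \<open>?E\<close> leaves no
  other solution.\<close>

lemma connection_ideal_iff:
  assumes D: "\<And>xs. length xs = V.n \<Longrightarrow> wedge sV (map \<phi> xs) = scale_fun D (wedge sV xs)"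
    and \<aa>: "int_ideal \<aa>"
  shows "exterior_power sV V.n (root_lattice sV R) =
      ideal_times scale_fun \<aa> (exterior_power sV V.n (weight_lattice sW pair R)) \<longleftrightarrow>
    \<aa> = {D * c | c. c \<in> integers_of}"
proof -
  let ?P = "weight_lattice sW pair R"
  let ?E = "exterior_power sV V.n ?P"
  have "{wedge sV ys |ys. length ys = V.n \<and> set ys \<subseteq> root_lattice sV R} =
      scale_fun D ` {wedge sV xs |xs. length xs = V.n \<and> set xs \<subseteq> ?P}" (is "?L = ?R")
  proof
    show "?R \<subseteq> ?L"
    proof
      fix y assume "y \<in> ?R"
      then obtain xs where xs: "length xs = V.n" "set xs \<subseteq> ?P" "y = scale_fun D (wedge sV xs)" by blast
      then have "y = wedge sV (map \<phi> xs)" "length (map \<phi> xs) = V.n" "set (map \<phi> xs) \<subseteq> root_lattice sV R"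
        using D[OF xs(1)] root_lattice_eq by auto
      then show "y \<in> ?L" by blast
    qed
    show "?L \<subseteq> ?R"
    proof
      fix y assume "y \<in> ?L"
      then obtain ys where ys: "length ys = V.n" "set ys \<subseteq> \<phi> ` ?P" "y = wedge sV ys"
        using root_lattice_eq by blast
      then have "ys \<in> map \<phi> ` lists ?P" by (simp add: lists_image[symmetric] in_lists_conv_set subset_iff)
      then obtain xs where "set xs \<subseteq> ?P" "ys = map \<phi> xs" by (auto simp: in_lists_conv_set)
      moreover from this have "length xs = V.n" using ys(1) by simp
      ultimately show "y \<in> ?R" using D ys(3) by auto
    qed
  qed
  then have Q: "exterior_power sV V.n (root_lattice sV R) = scale_fun D ` ?E"
    unfolding exterior_power_def
    by (simp only:) (rule int_span_image; simp add: scale_fun_def algebra_simps fun_eq_iff)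
  have E: "int_submodule scale_fun ?E"
    unfolding exterior_power_def by (rule int_submodule_int_span)
  show ?thesis
  proof
    assume "\<aa> = {D * c | c. c \<in> integers_of}"
    then show "exterior_power sV V.n (root_lattice sV R) = ideal_times scale_fun \<aa> ?E"
      using principal_ideal_times[OF E] Q by simp
  next
    assume eq: "exterior_power sV V.n (root_lattice sV R) = ideal_times scale_fun \<aa> ?E"
    show "\<aa> = {D * c | c. c \<in> integers_of}"
      by (rule cancel_invertible_module[OF integers_ring T(2)
            one_in_normalized_ideal[OF root_in[OF \<rho>(1)] vw] wedge_weight_lattice_dual \<aa> eq[unfolded Q, symmetric]])
  qed
qed

end

text \<open>The right-hand side mentions only \<open>D\<close>, which comes from \<open>T\<close>.
  Keeping \<open>int_ideal\<close> under \<open>THE\<close> gives this common description without a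
  separate proof that \<open>D\<close> is integral.\<close>

lemma connection_index_eq_generators:
  assumes irr: "irreducible_group sV G"
    and T: "G = generate (GL sV) T" "finite T" "card T \<le> V.n" "T \<subseteq> refl ` R"
    and D: "\<And>xs. length xs = V.n \<Longrightarrow>
      wedge sV (map (sum_id_minus T) xs) = scale_fun D (wedge sV xs)"
  shows "connection_index sV sW pair R = (THE \<aa>. int_ideal \<aa> \<and> \<aa> = {D * c | c. c \<in> integers_of})"
proof -
  have "\<exists>r. r \<in> R \<and> refl r = t" if "t \<in> T" for t using T(4) that by blast
  then obtain \<rho> where \<rho>: "\<And>t. t \<in> T \<Longrightarrow> \<rho> t \<in> R" "\<And>t. t \<in> T \<Longrightarrow> refl (\<rho> t) = t" by metis
  have "\<exists>v w. normal_pair (\<rho> t) v w" if "t \<in> T" for t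
    by (rule ex_normal_pair[OF root_in[OF \<rho>(1)[OF that]]])
  then obtain v w where vw: "\<And>t. t \<in> T \<Longrightarrow> normal_pair (\<rho> t) (v t) (w t)" by metis
  have "(int_ideal \<aa> \<and> exterior_power sV V.n (root_lattice sV R) =
      ideal_times scale_fun \<aa> (exterior_power sV V.n (weight_lattice sW pair R))) \<longleftrightarrow>
    (int_ideal \<aa> \<and> \<aa> = {D * c | c. c \<in> integers_of})" for \<aa>
    using connection_ideal_iff[OF irr T(1-3) \<rho> vw] D by auto
  then show ?thesis unfolding connection_index_def char_ideal_def Let_def by presburger
qed

end

end

theorem mainTheorem2:
  fixes emb :: "'k::field_char_0 \<Rightarrow> complex"
    and sV :: "'k \<Rightarrow> 'v::ab_group_add \<Rightarrow> 'v"
    and sW :: "'k \<Rightarrow> 'w::ab_group_add \<Rightarrow> 'w"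
    and pair :: "'v \<Rightarrow> 'w \<Rightarrow> 'k"
    and G :: "('v \<Rightarrow> 'v) set"
    and R R' :: "('k, 'v, 'w) root set"
  assumes "hermitian_pairing emb sV sW pair"
    and "finite_reflection_group sV G"
    and "irreducible_group sV G"
    and "well_generated sV G"
    and "distinguished_root_system emb sV sW pair R"
    and "distinguished_root_system emb sV sW pair R'"
    and "root_system_group sV sW pair R = G"
    and "root_system_group sV sW pair R' = G"
  shows "connection_index sV sW pair R = connection_index sV sW pair R'"
proof -
  interpret hermitian_pairing emb sV sW pair by fact
  have G: "subgroup G (GL sV)" "finite G"
    using assms(2) by (simp_all add: finite_reflection_group_def)
  note R = assms(5,7) G and R' = assms(6,8) G
  obtain S where S: "finite S" "card S = V.n" "\<And>t. t \<in> S \<Longrightarrow> is_reflection sV t" "G = generate (GL sV) S"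
    using assms(4) unfolding well_generated_def by blast
  have t: "t \<in> G" "V.hyperplane (fixed_space t)" if "t \<in> S" for t
  proof -
    show "t \<in> G" unfolding S(4) using that by (rule generate.incl)
    then have "V.subspace (fixed_space t)"
      by (simp add: V.subspace_def fixed_space_def V.linear_mapD[OF V.subgroup_GL(3)[OF G(1)]])
    then show "V.hyperplane (fixed_space t)"
      using S(3)[OF that] by (intro V.hyperplane_if_dim) (simp_all add: is_reflection_def)
  qed
  have "\<exists>r. r \<in> R \<and> fixed_space (refl r) = fixed_space t \<and> (\<exists>j. t = refl r ^^ j)" if "t \<in> S" for t
    using reflection_power_of_root_reflection[OF R t[OF that]] by blast
  then obtain \<rho> where \<rho>: "\<And>t. t \<in> S \<Longrightarrow> \<rho> t \<in> R" "\<And>t. t \<in> S \<Longrightarrow> fixed_space (refl (\<rho> t)) = fixed_space t"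
      "\<And>t. t \<in> S \<Longrightarrow> \<exists>j. t = refl (\<rho> t) ^^ j"
    by metis
  have "\<exists>r. r \<in> R' \<and> fixed_space (refl r) = fixed_space t" if "t \<in> S" for t
    using reflection_power_of_root_reflection[OF R' t[OF that]] by blast
  then obtain \<rho>' where \<rho>': "\<And>t. t \<in> S \<Longrightarrow> \<rho>' t \<in> R'" "\<And>t. t \<in> S \<Longrightarrow> fixed_space (refl (\<rho>' t)) = fixed_space t"
    by metis
  \<comment> \<open>Both systems attach the same reflection to the hyperplane of \<open>t\<close>,
    so one set \<open>T\<close> serves for both.\<close>
  have same: "refl (\<rho>' t) = refl (\<rho> t)" if t: "t \<in> S" for t
    by (rule distinguished_reflection_unique[OF G])
      (use distinguished_refl[OF R \<rho>(1)[OF t]] distinguished_refl[OF R' \<rho>'(1)[OF t]]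
        hyperplane_refl[OF R \<rho>(1)[OF t]] \<rho>(2)[OF t] \<rho>'(2)[OF t] in simp_all)
  \<comment> \<open>A priori two elements of \<open>S\<close> may share a hyperplane, so at this
    point the cardinality of \<open>T\<close> is only bounded above.\<close>
  define T where "T = (\<lambda>t. refl (\<rho> t)) ` S"
  have T: "finite T" "card T \<le> V.n" "T \<subseteq> refl ` R"
    using S(1,2) card_image_le[OF S(1)] \<rho>(1) unfolding T_def by auto
  have T': "T \<subseteq> refl ` R'"
    unfolding T_def
  proof (rule image_subsetI)
    fix t assume t: "t \<in> S"
    show "refl (\<rho> t) \<in> refl ` R'" unfolding same[OF t, symmetric] by (rule imageI[OF \<rho>'(1)[OF t]])
  qed
  have TG: "T \<subseteq> G" using refl_in[OF R \<rho>(1)] by (auto simp: T_def)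
  have "T \<subseteq> carrier (GL sV)" using TG subgroup.subset[OF G(1)] by blast
  then have sub: "subgroup (generate (GL sV) T) (GL sV)"
    by (rule group.generate_is_subgroup[OF V.group_GL])
  \<comment> \<open>Elements of \<open>S\<close> are powers of elements of \<open>T\<close>, so
    passing to distinguished reflections does not shrink the generated group.\<close>
  have pow: "a ^^ j \<in> generate (GL sV) T" if "a \<in> T" for a j
    by (induction j) (simp_all only: funpow.simps V.subgroup_GL(1,2)[OF sub] generate.incl[OF that])
  have "S \<subseteq> generate (GL sV) T"
  proof
    fix t assume t: "t \<in> S"
    then have "refl (\<rho> t) \<in> T" by (simp add: T_def)
    then show "t \<in> generate (GL sV) T" using pow \<rho>(3)[OF t] by metis
  qed
  then have "G \<subseteq> generate (GL sV) T"
    unfolding S(4) by (rule group.generate_subgroup_incl[OF V.group_GL _ sub])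
  moreover have "generate (GL sV) T \<subseteq> G"
    by (rule group.generate_subgroup_incl[OF V.group_GL TG G(1)])
  ultimately have gen: "G = generate (GL sV) T" by blast
  have "Vector_Spaces.linear sV sV (sum_id_minus T)"
    using V.subgroup_GL(3)[OF G(1)] TG by (intro linear_sum_id_minus) blast
  then obtain D where
    D: "\<And>xs. length xs = V.n \<Longrightarrow> wedge sV (map (sum_id_minus T) xs) = scale_fun D (wedge sV xs)"
    using V.ex_wedge_scalar by blast
  show ?thesis
    using connection_index_eq_generators[OF R assms(3) gen T D]
      connection_index_eq_generators[OF R' assms(3) gen T(1,2) T' D] by simp
qed

end
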